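(* Let $\Omega\subset\mathbb{R}^d$ be a bounded domain. Suppose that the activation function $\sigma\in L^1(\mathbb{R})\cap L^\infty(\mathbb{R})$ is non-zero. Then there is a constant $C(\mathrm{diam}(\Omega),\sigma)$, depending only on $\mathrm{diam}(\Omega)$ and $\sigma$, such that for every $f\in\mathcal{B}^1$ and every integer $n\ge1$, $$\inf_{f_n\in\Sigma_d^n(\sigma)}\|f-f_n\|_{L^2(\Omega)}\le|\Omega|^{1/2}\,C(\mathrm{diam}(\Omega),\sigma)\,n^{-1/4}\,\|f\|_{\mathcal{B}^1}.$$
   Context: For $\sigma:\mathbb{R}\to\mathbb{R}$, $\Sigma_d^n(\sigma)=\{x\mapsto\sum_{i=1}^n\beta_i\sigma(\omega_i\cdot x+b_i):\omega_i\in\mathbb{R}^d,\ b_i,\beta_i\in\mathbb{R}\}$. Fourier convention: $\hat f(\omega)=(2\pi)^{-d}\int_{\mathbb{R}^d} f(x)e^{-i\omega\cdot x}dx$, so that $f(x)=\int_{\mathbb{R}^d}e^{i\omega\cdot x}\hat f(\omega)d\omega$. The Barron norm of $f:\mathbb{R}^d\to\mathbb{R}$ is $\|f\|_{\mathcal{B}^s}=\int_{\mathbb{R}^d}(1+|\omega|)^s|\hat f(\omega)|\,d\omega$, and $\mathcal{B}^s=\{f:\|f\|_{\mathcal{B}^s}<\infty\}$ (real-valued functions whose Fourier transform is a function with this integral finite). $|\Omega|$ is the Lebesgue measure of $\Omega$. "Non-zero" means not almost everywhere zero. *)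

theory Defs
  imports "HOL-Analysis.Analysis"
begin

section \<open>Euclidean space with a variable dimension\<close>

text \<open>
  The dimension \<open>d\<close> has to be quantified inside formulas (constants must not depend on it), so
  \<open>d\<close>-dimensional space is modelled by the extensional functions on \<open>{..<d}\<close>: this is the carrier
  both of the product measure \<^const>\<open>PiM\<close> and of the product topology \<open>powertop_real {..<d}\<close>.
\<close>

definition Rn :: "nat \<Rightarrow> (nat \<Rightarrow> real) set" where
  "Rn d = {..<d} \<rightarrow>\<^sub>E UNIV"

definition dotp :: "nat \<Rightarrow> (nat \<Rightarrow> real) \<Rightarrow> (nat \<Rightarrow> real) \<Rightarrow> real" where
  "dotp d x y = (\<Sum>i<d. x i * y i)"

definition enorm :: "nat \<Rightarrow> (nat \<Rightarrow> real) \<Rightarrow> real" where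
  "enorm d x = L2_set x {..<d}"

definition ediam :: "nat \<Rightarrow> (nat \<Rightarrow> real) set \<Rightarrow> real" where
  "ediam d S = (SUP (x, y)\<in>S \<times> S. enorm d (\<lambda>i. x i - y i))"

text \<open>The product measure lives on the Borel sets; its completion is Lebesgue measure.\<close>

definition lebesgue_Rn :: "nat \<Rightarrow> (nat \<Rightarrow> real) measure" where
  "lebesgue_Rn d = completion (PiM {..<d} (\<lambda>_. lborel))"

definition bounded_domain :: "nat \<Rightarrow> (nat \<Rightarrow> real) set \<Rightarrow> bool" where
  "bounded_domain d S \<longleftrightarrow>
     S \<noteq> {} \<and> openin (powertop_real {..<d}) S \<and> connectedin (powertop_real {..<d}) S \<and>
     (\<exists>B. \<forall>x\<in>S. enorm d x \<le> B)"

text \<open>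
  Being \<^typ>\<open>ennreal\<close>-valued, this is \<open>\<infinity>\<close> (and not \<open>0\<close>) when \<open>f\<close> is not square integrable on \<open>S\<close>.
\<close>

definition L2_norm_on :: "nat \<Rightarrow> (nat \<Rightarrow> real) set \<Rightarrow> ((nat \<Rightarrow> real) \<Rightarrow> real) \<Rightarrow> ennreal" where
  "L2_norm_on d S f =
     (let I = (\<integral>\<^sup>+x\<in>S. ennreal ((f x)\<^sup>2) \<partial>lebesgue_Rn d)
      in if I = \<infinity> then \<infinity> else ennreal (sqrt (enn2real I)))"


section \<open>Fourier transform of tempered functions\<close>

text \<open>
  \<open>D \<alpha>\<close> is the iterated partial derivative of \<open>\<phi>\<close> along the list of directions \<open>\<alpha>\<close>.
\<close>

definition schwartz :: "nat \<Rightarrow> ((nat \<Rightarrow> real) \<Rightarrow> complex) \<Rightarrow> bool" where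
  "schwartz d \<phi> \<longleftrightarrow>
     (\<exists>D. D [] = \<phi> \<and>
        (\<forall>\<alpha>. set \<alpha> \<subseteq> {..<d} \<longrightarrow>
           continuous_map (powertop_real {..<d}) euclidean (D \<alpha>) \<and>
           (\<forall>x\<in>Rn d. \<forall>i<d.
              ((\<lambda>t. D \<alpha> (x(i := t))) has_vector_derivative D (i # \<alpha>) x) (at (x i))) \<and>
           (\<forall>N::nat. \<exists>B. \<forall>x\<in>Rn d. (1 + enorm d x) ^ N * norm (D \<alpha> x) \<le> B)))"

definition fourier_integral ::
    "nat \<Rightarrow> ((nat \<Rightarrow> real) \<Rightarrow> complex) \<Rightarrow> (nat \<Rightarrow> real) \<Rightarrow> complex" where
  "fourier_integral d \<phi> \<omega> =
     (1 / (2 * pi) ^ d) *\<^sub>R (\<integral>x. \<phi> x * exp (- (\<i> * of_real (dotp d \<omega> x))) \<partial>lebesgue_Rn d)"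

definition tempered_function :: "nat \<Rightarrow> ((nat \<Rightarrow> real) \<Rightarrow> complex) \<Rightarrow> bool" where
  "tempered_function d f \<longleftrightarrow>
     (\<exists>N::nat. integrable (lebesgue_Rn d) (\<lambda>x. f x / of_real ((1 + enorm d x) ^ N)))"

text \<open>
  The Fourier transform of \<open>f\<close> in the sense of tempered distributions is the function \<open>g\<close>.
  For integrable \<open>f\<close> this means \<open>g = fourier_integral d f\<close> almost everywhere, by Fubini; but a
  function with integrable Fourier transform, e.g. \<open>sin x / x\<close> on the line, need not be integrable.
\<close>

definition has_fourier_transform ::
    "nat \<Rightarrow> ((nat \<Rightarrow> real) \<Rightarrow> complex) \<Rightarrow> ((nat \<Rightarrow> real) \<Rightarrow> complex) \<Rightarrow> bool" where
  "has_fourier_transform d f g \<longleftrightarrow>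
     tempered_function d f \<and> tempered_function d g \<and>
     (\<forall>\<phi>. schwartz d \<phi> \<longrightarrow>
        (\<integral>\<omega>. g \<omega> * \<phi> \<omega> \<partial>lebesgue_Rn d) = (\<integral>x. f x * fourier_integral d \<phi> x \<partial>lebesgue_Rn d))"

text \<open>Such a \<open>g\<close> is unique up to null sets, so the choice does not affect the Barron norm.\<close>

definition fourier_transform ::
    "nat \<Rightarrow> ((nat \<Rightarrow> real) \<Rightarrow> real) \<Rightarrow> (nat \<Rightarrow> real) \<Rightarrow> complex" where
  "fourier_transform d f = (SOME g. has_fourier_transform d (\<lambda>x. of_real (f x)) g)"


section \<open>Barron spaces and shallow networks\<close>

definition barron_norm :: "nat \<Rightarrow> real \<Rightarrow> ((nat \<Rightarrow> real) \<Rightarrow> real) \<Rightarrow> ennreal" where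
  "barron_norm d s f =
     (\<integral>\<^sup>+\<omega>. ennreal ((1 + enorm d \<omega>) powr s * norm (fourier_transform d f \<omega>)) \<partial>lebesgue_Rn d)"

definition barron_space :: "nat \<Rightarrow> real \<Rightarrow> ((nat \<Rightarrow> real) \<Rightarrow> real) set" where
  "barron_space d s =
     {f. (\<exists>g. has_fourier_transform d (\<lambda>x. of_real (f x)) g) \<and> barron_norm d s f < \<infinity>}"

definition shallow_nets :: "(real \<Rightarrow> real) \<Rightarrow> nat \<Rightarrow> nat \<Rightarrow> ((nat \<Rightarrow> real) \<Rightarrow> real) set" where
  "shallow_nets \<sigma> d n =
     {(\<lambda>x. \<Sum>i<n. \<beta> i * \<sigma> (dotp d (\<omega> i) x + b i)) | \<omega> b \<beta>. \<forall>i<n. \<omega> i \<in> Rn d}"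

end

theory Submission
  imports Defs "HOL-Probability.Probability"
begin

text \<open>
  Replace \<open>\<sigma>\<close> by a Borel representative \<open>s\<close>, which lies in \<open>L\<^sup>1 \<inter> L\<^sup>2\<close>. Its Fourier transform is continuous
  and not identically zero, hence bounded away from zero near some \<open>a \<noteq> 0\<close>. Inverting it on a window of
  width of order \<open>1 / l\<close> around \<open>a\<close> gives a kernel \<open>k\<close> with \<open>\<parallel>k\<parallel>\<^sub>2\<^sup>2 = O(l)\<close> such that \<open>\<integral> s(t + b) k(b) db\<close>
  differs from \<open>exp(- i a t)\<close> by at most \<open>|t| / l\<close>. Inserting \<open>t = - \<omega> \<cdot> (x - x\<^sub>0) / a\<close> into Fourier inversion for \<open>f\<close>
  writes \<open>f\<close> on \<open>\<Omega>\<close>, up to an error \<open>O(\<parallel>f\<parallel> / l)\<close>, as an integral of neurons over \<open>(\<omega>, b)\<close>. Monte Carlo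
  sampling with density proportional to \<open>|f^(\<omega>)| |k(b)|\<^sup>2\<close> has variance \<open>O(l \<parallel>f\<parallel>\<^sup>2 / n)\<close>, and \<open>l = \<surd>n\<close> balances
  the two errors.
\<close>

section \<open>Fourier analysis on the line\<close>

text \<open>Nothing is assumed on decay or smoothness of \<open>\<sigma>\<close>, so its transform
  is merely continuous and its reciprocal is usable only on a small window. The sharp cut-off makes
  the resulting kernel non-integrable; it is controlled in L2 alone. This forces a sampling density
  quadratic in the kernel, so that L2 norms of kernel and activation replace an L1 norm of the
  kernel, and it is why boundedness of \<open>\<sigma>\<close> enters: it puts \<open>s\<close> into
  L2.

  All phases are produced from the single frequency \<open>a\<close> by rescaling with
  \<open>1 / a\<close>, hence \<open>a\<close> must not be 0. Centring at a point of the domain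
  costs only a phase in the coefficients and leaves the diameter as the only geometric quantity in
  the constant.

  Null sets need care twice. A neuron with zero weight is constant and sees a point value of
  \<open>\<sigma>\<close>, so passing from \<open>s\<close> back to \<open>\<sigma>\<close> may fail
  for exceptional parameters, which the sample has to avoid. And the transform of \<open>f\<close>
  is given only through pairings with test functions, so the inversion formula has to be earned
  first and holds only almost everywhere.\<close>

lemma fourier_L1_unique:
  fixes s :: "real \<Rightarrow> real"
  assumes s: "integrable lborel s"
    and zero: "\<And>\<xi>. (\<integral>x. s x *\<^sub>R iexp (\<xi> * x) \<partial>lborel) = 0"
  shows "AE x in lborel. s x = 0"
proof -
  \<comment> \<open>The positive and negative parts of \<open>s\<close> have equal mass and, once normalised, equal characteristic functions.\<close>
  define p where "p = (\<lambda>x. max (s x) 0)"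
  define q where "q = (\<lambda>x. max (- s x) 0)"
  have p: "integrable lborel p" and q: "integrable lborel q"
    unfolding p_def q_def using s by (auto intro!: integrable_max)
  have p0: "\<And>x. 0 \<le> p x" and q0: "\<And>x. 0 \<le> q x" and spq: "\<And>x. s x = p x - q x"
    by (auto simp: p_def q_def)
  have bm[measurable]: "p \<in> borel_measurable borel" "q \<in> borel_measurable borel"
    using p q by auto
  have ip: "integrable lborel (\<lambda>x. p x *\<^sub>R iexp (\<xi> * x))" for \<xi>
    by (rule Bochner_Integration.integrable_bound[OF p]) auto
  have iq: "integrable lborel (\<lambda>x. q x *\<^sub>R iexp (\<xi> * x))" for \<xi>
    by (rule Bochner_Integration.integrable_bound[OF q]) auto
  have eq: "(\<integral>x. p x *\<^sub>R iexp (\<xi> * x) \<partial>lborel) = (\<integral>x. q x *\<^sub>R iexp (\<xi> * x) \<partial>lborel)" for \<xi>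
    using zero[of \<xi>] ip[of \<xi>] iq[of \<xi>] by (simp add: spq scaleR_diff_left)
  define m where "m = integral\<^sup>L lborel p"
  have mq: "integral\<^sup>L lborel q = m"
    using eq[of 0] unfolding m_def by (simp add: scaleR_conv_of_real)
  have m0: "0 \<le> m" unfolding m_def using p0 by (simp add: integral_nonneg)
  show ?thesis
  proof (cases "m = 0")
    case True
    have "AE x in lborel. p x = 0" "AE x in lborel. q x = 0"
      using True mq integral_nonneg_eq_0_iff_AE[OF p] integral_nonneg_eq_0_iff_AE[OF q] p0 q0
      unfolding m_def by auto
    then show ?thesis by eventually_elim (simp add: spq)
  next
    case False
    with m0 have mpos: "m > 0" by simp
    have nn: "(\<integral>\<^sup>+x. ennreal (u x / m) \<partial>lborel) = 1"
      if "integrable lborel u" "\<And>x. 0 \<le> u x" "integral\<^sup>L lborel u = m" for u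
      using that mpos by (subst nn_integral_eq_integral) auto
    have rd: "real_distribution (density lborel (\<lambda>x. ennreal (u x / m)))"
      if "integrable lborel u" "\<And>x. 0 \<le> u x" "integral\<^sup>L lborel u = m" for u
      using nn[OF that] that(1)
      by (auto simp: real_distribution_def real_distribution_axioms_def intro!: prob_spaceI
               simp: emeasure_density)
    have ch: "char (density lborel (\<lambda>x. ennreal (u x / m))) \<xi>
                = (\<integral>x. u x *\<^sub>R iexp (\<xi> * x) \<partial>lborel) / m"
      if "integrable lborel u" "\<And>x. 0 \<le> u x" for u \<xi>
    proof -
      have [measurable]: "u \<in> borel_measurable borel" using that by auto
      have "char (density lborel (\<lambda>x. ennreal (u x / m))) \<xi>
         = (\<integral>x. (u x / m) *\<^sub>R iexp (\<xi> * x) \<partial>lborel)"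
        unfolding char_def using that mpos by (subst integral_density) auto
      also have "\<dots> = (\<integral>x. (1 / m) *\<^sub>R (u x *\<^sub>R iexp (\<xi> * x)) \<partial>lborel)"
        by (rule Bochner_Integration.integral_cong) auto
      also have "\<dots> = (1 / m) *\<^sub>R (\<integral>x. u x *\<^sub>R iexp (\<xi> * x) \<partial>lborel)"
        by (rule integral_scaleR_right)
      finally show ?thesis by (simp add: scaleR_conv_of_real)
    qed
    have "char (density lborel (\<lambda>x. ennreal (p x / m))) = char (density lborel (\<lambda>x. ennreal (q x / m)))"
      by (rule ext) (simp only: ch[OF p p0] ch[OF q q0] eq)
    then have "density lborel (\<lambda>x. ennreal (p x / m)) = density lborel (\<lambda>x. ennreal (q x / m))"
      using p q p0 q0 mq by (intro Levy_uniqueness rd) (auto simp: m_def)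
    then have "AE x in lborel. ennreal (p x / m) = ennreal (q x / m)"
      using nn[OF p p0] by (subst finite_density_unique[symmetric]) (auto simp: m_def)
    then show ?thesis
    proof eventually_elim
      case (elim x)
      then have "p x = q x" using p0[of x] q0[of x] mpos by (auto simp: ennreal_eq_0_iff)
      then show ?case by (simp add: spq)
    qed
  qed
qed

lemma fourier_L1_isCont:
  fixes s :: "real \<Rightarrow> real"
  assumes s: "integrable lborel s"
  shows "isCont (\<lambda>\<xi>. \<integral>x. s x *\<^sub>R iexp (\<xi> * x) \<partial>lborel) \<xi>\<^sub>0"
proof -
  have [measurable]: "s \<in> borel_measurable borel" using s by auto
  show ?thesis unfolding continuous_at_sequentially comp_def
  proof safe
    fix u :: "nat \<Rightarrow> real" assume u: "u \<longlonglongrightarrow> \<xi>\<^sub>0"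
    show "(\<lambda>n. \<integral>x. s x *\<^sub>R iexp (u n * x) \<partial>lborel) \<longlonglongrightarrow> (\<integral>x. s x *\<^sub>R iexp (\<xi>\<^sub>0 * x) \<partial>lborel)"
      by (rule integral_dominated_convergence[where w="\<lambda>x. \<bar>s x\<bar>"])
         (use s u in \<open>auto intro!: always_eventually tendsto_eq_intros\<close>)
  qed
qed

text \<open>A nonzero value of the transform may be found at the origin, where it is of no use
  because of the later division by \<open>a\<close>; continuity then supplies a nonzero frequency
  nearby.\<close>

lemma fourier_L1_lower_bound:
  fixes s :: "real \<Rightarrow> real"
  assumes s: "integrable lborel s" and nz: "\<not> (AE x in lborel. s x = 0)"
  obtains a \<delta> c where "a \<noteq> 0" "\<delta> > 0" "c > 0"
    "\<And>\<xi>. \<bar>\<xi> - a\<bar> \<le> \<delta> \<Longrightarrow> c \<le> norm (\<integral>x. s x *\<^sub>R iexp (\<xi> * x) \<partial>lborel)"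
proof -
  define S where "S = (\<lambda>\<xi>. \<integral>x. s x *\<^sub>R iexp (\<xi> * x) \<partial>lborel)"
  have cont: "isCont S \<xi>" for \<xi> unfolding S_def by (rule fourier_L1_isCont[OF s])
  have near: "\<exists>\<delta>>0. \<forall>y. \<bar>y - b\<bar> \<le> \<delta> \<longrightarrow> norm (S b) / 2 \<le> norm (S y)" if nzb: "S b \<noteq> 0" for b
  proof -
    obtain d where d: "d > 0" "\<And>y. norm (y - b) < d \<Longrightarrow> norm (S y - S b) < norm (S b) / 2"
      using cont[of b, unfolded continuous_at_eps_delta, rule_format, of "norm (S b) / 2"] nzb
      unfolding dist_norm by (metis half_gt_zero zero_less_norm_iff)
    have "norm (S b) / 2 \<le> norm (S y)" if "\<bar>y - b\<bar> \<le> d / 2" for y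
      using d(2)[of y] that d(1) norm_triangle_ineq2[of "S b" "S y"]
      by (auto simp: norm_minus_commute)
    then show ?thesis using d(1) by (intro exI[of _ "d/2"]) auto
  qed
  obtain b where b: "S b \<noteq> 0"
    using fourier_L1_unique[OF s] nz unfolding S_def by auto
  have "\<exists>a. a \<noteq> 0 \<and> S a \<noteq> 0"
  proof (cases "b = 0")
    case True
    obtain \<delta> where "\<delta> > 0" "\<forall>y. \<bar>y - b\<bar> \<le> \<delta> \<longrightarrow> norm (S b) / 2 \<le> norm (S y)"
      using near[OF b] by auto
    then show ?thesis using b True
      by (intro exI[of _ \<delta>]) (metis abs_of_pos diff_zero half_gt_zero less_le_not_le norm_zero order_refl zero_less_norm_iff)
  qed (use b in auto)
  then obtain a where a: "a \<noteq> 0" "S a \<noteq> 0" by auto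
  obtain \<delta> where "\<delta> > 0" "\<forall>y. \<bar>y - a\<bar> \<le> \<delta> \<longrightarrow> norm (S a) / 2 \<le> norm (S y)"
    using near[OF a(2)] by auto
  then show ?thesis using a by (intro that[of a \<delta> "norm (S a) / 2"]) (auto simp: S_def)
qed

section \<open>Gaussians and Bessel's inequality for the Fourier transform\<close>

lemma fourier_normal_density:
  assumes "\<epsilon> > 0"
  shows "(\<integral>x. normal_density \<mu> \<epsilon> x *\<^sub>R iexp (t * x) \<partial>lborel) = iexp (t * \<mu>) * exp (- (\<epsilon> * t)\<^sup>2 / 2)"
proof -
  have "(\<integral>x. normal_density \<mu> \<epsilon> x *\<^sub>R iexp (t * x) \<partial>lborel)
      = \<bar>\<epsilon>\<bar> *\<^sub>R (\<integral>x. normal_density \<mu> \<epsilon> (\<mu> + \<epsilon> * x) *\<^sub>R iexp (t * (\<mu> + \<epsilon> * x)) \<partial>lborel)"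
    using assms by (intro lborel_integral_real_affine) auto
  also have "\<dots> = (\<integral>x. \<epsilon> *\<^sub>R (normal_density \<mu> \<epsilon> (\<mu> + \<epsilon> * x) *\<^sub>R iexp (t * (\<mu> + \<epsilon> * x))) \<partial>lborel)"
    using assms by (subst integral_scaleR_right) simp
  also have "\<dots> = (\<integral>x. iexp (t * \<mu>) * (std_normal_density x *\<^sub>R iexp (t * \<epsilon> * x)) \<partial>lborel)"
  proof (rule Bochner_Integration.integral_cong[OF refl])
    fix x :: real
    have "\<epsilon> * normal_density \<mu> \<epsilon> (\<mu> + \<epsilon> * x) = std_normal_density x"
      using assms by (simp add: normal_density_def real_sqrt_mult power_mult_distrib)
    moreover have "iexp (t * (\<mu> + \<epsilon> * x)) = iexp (t * \<mu>) * iexp (t * \<epsilon> * x)"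
      by (simp add: exp_add[symmetric] algebra_simps)
    ultimately show "\<epsilon> *\<^sub>R (normal_density \<mu> \<epsilon> (\<mu> + \<epsilon> * x) *\<^sub>R iexp (t * (\<mu> + \<epsilon> * x)))
       = iexp (t * \<mu>) * (std_normal_density x *\<^sub>R iexp (t * \<epsilon> * x))"
      by (metis (no_types, lifting) mult_scaleR_right scaleR_scaleR)
  qed
  also have "\<dots> = iexp (t * \<mu>) * (\<integral>x. std_normal_density x *\<^sub>R iexp (t * \<epsilon> * x) \<partial>lborel)"
    by (rule integral_mult_right_zero)
  also have "(\<integral>x. std_normal_density x *\<^sub>R iexp (t * \<epsilon> * x) \<partial>lborel) = char std_normal_distribution (t * \<epsilon>)"
    unfolding char_def by (subst integral_density) auto
  also have "\<dots> = exp (- (\<epsilon> * t)\<^sup>2 / 2)"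
    by (simp add: char_std_normal_distribution mult.commute)
  finally show ?thesis .
qed

lemma integrable_mult_fst_snd:
  fixes f :: "'a \<Rightarrow> 'c::{real_normed_field, banach, second_countable_topology}"
  assumes sf: "sigma_finite_measure M1" "sigma_finite_measure M2"
    and f: "integrable M1 f" and g: "integrable M2 g"
  shows "integrable (M1 \<Otimes>\<^sub>M M2) (\<lambda>z. f (fst z) * g (snd z))"
proof -
  interpret pair_sigma_finite M1 M2 using sf by (simp add: pair_sigma_finite_def)
  have [measurable]: "f \<in> borel_measurable M1" "g \<in> borel_measurable M2" using f g by auto
  show ?thesis
  proof (rule Fubini_integrable)
    show "(\<lambda>z. f (fst z) * g (snd z)) \<in> borel_measurable (M1 \<Otimes>\<^sub>M M2)" by measurable
    show "integrable M1 (\<lambda>x. \<integral>y. norm (f (fst (x, y)) * g (snd (x, y))) \<partial>M2)"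
      using f by (simp add: norm_mult)
    show "AE x in M1. integrable M2 (\<lambda>y. f (fst (x, y)) * g (snd (x, y)))"
      using g by auto
  qed
qed

lemma gaussian_eq_normal_density:
  assumes "\<epsilon> > 0"
  shows "exp (- (\<epsilon> * b)\<^sup>2 / 2) = sqrt (2 * pi) / \<epsilon> * normal_density 0 (1 / \<epsilon>) b"
  using assms
  by (simp add: normal_density_def real_sqrt_divide real_sqrt_mult power_mult_distrib field_simps)

text \<open>The right side is \<open>2 * pi\<close> times a probability density concentrating at 0
  as \<open>\<epsilon>\<close> shrinks. This is the origin of the constant \<open>2 * pi\<close> in
  \<open>bessel\<close>.\<close>

lemma fourier_gaussian:
  assumes \<epsilon>: "\<epsilon> > 0"
  shows "(\<integral>b. complex_of_real (exp (- (\<epsilon> * b)\<^sup>2 / 2)) * iexp (t * b) \<partial>lborel) = of_real (2 * pi * normal_density 0 \<epsilon> t)"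
proof -
  have "(\<integral>b. complex_of_real (exp (- (\<epsilon> * b)\<^sup>2 / 2)) * iexp (t * b) \<partial>lborel)
     = (\<integral>b. of_real (sqrt (2 * pi) / \<epsilon>) * (normal_density 0 (1/\<epsilon>) b *\<^sub>R iexp (t * b)) \<partial>lborel)"
    unfolding gaussian_eq_normal_density[OF \<epsilon>]
    by (rule Bochner_Integration.integral_cong) (auto simp: scaleR_conv_of_real)
  also have "\<dots> = of_real (sqrt (2 * pi) / \<epsilon>) * (\<integral>b. normal_density 0 (1/\<epsilon>) b *\<^sub>R iexp (t * b) \<partial>lborel)"
    by (rule integral_mult_right_zero)
  also have "\<dots> = of_real (sqrt (2 * pi) / \<epsilon> * exp (- (t / \<epsilon>)\<^sup>2 / 2))"
    using \<epsilon> by (subst fourier_normal_density) (auto simp: exp_of_real[symmetric])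
  also have "sqrt (2 * pi) / \<epsilon> * exp (- (t / \<epsilon>)\<^sup>2 / 2) = 2 * pi * normal_density 0 \<epsilon> t"
    using \<epsilon> by (simp add: normal_density_def real_sqrt_mult power_divide field_simps)
  finally show ?thesis .
qed

text \<open>Square integrability of \<open>k\<close> is unknown in advance, so a Gaussian weight in
  \<open>b\<close> makes the triple integral over \<open>b\<close> and two frequencies absolutely
  convergent. After Fubini the weight has become a normal density in the difference of the
  frequencies, and \<open>2 u v \<le> u^2 + v^2\<close> splits the integral into two terms in which
  that density has mass 1. Hence the bound does not depend on \<open>\<epsilon>\<close>.\<close>

lemma bessel_damped:
  fixes m :: "real \<Rightarrow> complex"
  assumes m: "integrable lborel m" and \<epsilon>: "\<epsilon> > 0"
  defines "k \<equiv> \<lambda>b. \<integral>\<xi>. m \<xi> * iexp (\<xi> * b) \<partial>lborel"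
  shows "(\<integral>\<^sup>+b. ennreal (exp (- (\<epsilon> * b)\<^sup>2 / 2) * (norm (k b))\<^sup>2) \<partial>lborel)
           \<le> ennreal (2 * pi) * (\<integral>\<^sup>+\<xi>. ennreal ((norm (m \<xi>))\<^sup>2) \<partial>lborel)"
proof -
  have [measurable]: "m \<in> borel_measurable borel" using m by auto
  have [measurable]: "cnj \<in> borel_measurable borel"
    by (intro borel_measurable_continuous_onI continuous_intros)
  define G where "G = (\<lambda>b::real. exp (- (\<epsilon> * b)\<^sup>2 / 2))"
  have GN: "G b = sqrt (2 * pi) / \<epsilon> * normal_density 0 (1 / \<epsilon>) b" for b
    unfolding G_def by (rule gaussian_eq_normal_density[OF \<epsilon>])
  have G0: "0 \<le> G b" for b by (simp add: G_def)
  have [measurable]: "G \<in> borel_measurable borel" unfolding G_def by measurable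
  have Gint: "integrable lborel G" unfolding GN[abs_def] using \<epsilon> by auto
  have GF: "(\<integral>b. of_real (G b) * iexp (t * b) \<partial>lborel) = of_real (2 * pi * normal_density 0 \<epsilon> t)" for t
    unfolding G_def by (rule fourier_gaussian[OF \<epsilon>])
  let ?L = "lborel \<Otimes>\<^sub>M (lborel :: real measure)"
  have sfL: "sigma_finite_measure ?L"
    by (rule lborel_pair.P.sigma_finite_measure_axioms)
  interpret Q: pair_sigma_finite ?L "lborel :: real measure" ..
  define w where "w = (\<lambda>z. m (fst z) * cnj (m (snd z)))"
  have w: "integrable ?L w" unfolding w_def by (rule integrable_mult_fst_snd[OF sigma_finite_lborel sigma_finite_lborel]) (use m in auto)
  have [measurable]: "w \<in> borel_measurable (borel \<Otimes>\<^sub>M borel)" unfolding w_def by measurable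
  have H: "integrable (?L \<Otimes>\<^sub>M lborel) (\<lambda>(z, b). of_real (G b) * (w z * iexp ((fst z - snd z) * b)))"
  proof (rule Bochner_Integration.integrable_bound)
    show "integrable (?L \<Otimes>\<^sub>M lborel) (\<lambda>z. w (fst z) * of_real (G (snd z)))"
      by (intro integrable_mult_fst_snd sigma_finite_lborel w sfL)
         (use Gint in auto)
  qed (auto simp: norm_mult split_beta)
  \<comment> \<open>Writing the square of the norm as \<open>k b\<close> times its conjugate turns
    it into a double integral over two independent frequencies.\<close>
  have k2: "(\<integral>z. of_real (G b) * (w z * iexp ((fst z - snd z) * b)) \<partial>?L) = of_real (G b * (norm (k b))\<^sup>2)" for b
  proof -
    have "(\<integral>z. w z * iexp ((fst z - snd z) * b) \<partial>?L)
       = (\<integral>z. (m (fst z) * iexp (fst z * b)) * cnj (m (snd z) * iexp (snd z * b)) \<partial>?L)"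
    proof (rule Bochner_Integration.integral_cong[OF refl])
      fix z :: "real \<times> real"
      have "iexp ((fst z - snd z) * b) = iexp (fst z * b) * cnj (iexp (snd z * b))"
        by (simp add: exp_cnj exp_add[symmetric] algebra_simps)
      then show "w z * iexp ((fst z - snd z) * b) = (m (fst z) * iexp (fst z * b)) * cnj (m (snd z) * iexp (snd z * b))"
        by (simp only: w_def complex_cnj_mult mult_ac)
    qed
    also have "\<dots> = (\<integral>\<xi>. \<integral>\<eta>. (m \<xi> * iexp (\<xi> * b)) * cnj (m \<eta> * iexp (\<eta> * b)) \<partial>lborel \<partial>lborel)"
    proof (subst lborel_pair.integral_fst'[symmetric])
      have "integrable lborel (\<lambda>\<xi>. m \<xi> * iexp (\<xi> * b))"
        by (rule Bochner_Integration.integrable_bound[OF m]) (auto simp: norm_mult)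
      then show "integrable ?L (\<lambda>z. (m (fst z) * iexp (fst z * b)) * cnj (m (snd z) * iexp (snd z * b)))"
        by (intro integrable_mult_fst_snd sigma_finite_lborel) (simp_all only: integrable_cnj)
    qed simp
    also have "\<dots> = (\<integral>\<xi>. (m \<xi> * iexp (\<xi> * b)) * cnj (k b) \<partial>lborel)"
      by (simp only: integral_mult_right_zero Bochner_Integration.integral_cnj k_def)
    also have "\<dots> = k b * cnj (k b)"
      by (simp only: integral_mult_left_zero k_def)
    also have "\<dots> = of_real ((norm (k b))\<^sup>2)"
      by (simp only: complex_norm_square)
    finally show ?thesis by (simp only: integral_mult_right_zero of_real_mult)
  qed
  have int: "integrable lborel (\<lambda>b. G b * (norm (k b))\<^sup>2)"
    using Q.integrable_snd[OF H] unfolding k2 by (simp only: complex_of_real_integrable_eq)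
  have "of_real (\<integral>b. G b * (norm (k b))\<^sup>2 \<partial>lborel)
      = (\<integral>b. \<integral>z. of_real (G b) * (w z * iexp ((fst z - snd z) * b)) \<partial>?L \<partial>lborel)"
    unfolding k2 by (rule integral_complex_of_real[symmetric])
  also have "\<dots> = (\<integral>z. \<integral>b. of_real (G b) * (w z * iexp ((fst z - snd z) * b)) \<partial>lborel \<partial>?L)"
    using Q.Fubini_integral[OF H] by simp
  also have "\<dots> = (\<integral>z. w z * (\<integral>b. of_real (G b) * iexp ((fst z - snd z) * b) \<partial>lborel) \<partial>?L)"
    by (subst integral_mult_right_zero[symmetric]) (simp add: mult_ac)
  also have "\<dots> = (\<integral>z. w z * of_real (2 * pi * normal_density 0 \<epsilon> (fst z - snd z)) \<partial>?L)"
    unfolding GF ..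
  finally have eq: "of_real (\<integral>b. G b * (norm (k b))\<^sup>2 \<partial>lborel)
      = (\<integral>z. w z * of_real (2 * pi * normal_density 0 \<epsilon> (fst z - snd z)) \<partial>?L)" .
  have [measurable]: "(\<lambda>z. normal_density (fst z) \<epsilon> (snd z)) \<in> borel_measurable (borel \<Otimes>\<^sub>M borel)"
      "(\<lambda>z. normal_density (snd z) \<epsilon> (fst z)) \<in> borel_measurable (borel \<Otimes>\<^sub>M borel)"
    unfolding normal_density_def by measurable
  have nd1: "(\<integral>\<^sup>+y. ennreal (normal_density \<mu> \<epsilon> y) \<partial>lborel) = 1" for \<mu>
    using \<epsilon> by (subst nn_integral_eq_integral) auto
  have "(\<integral>\<^sup>+b. ennreal (G b * (norm (k b))\<^sup>2) \<partial>lborel) = ennreal (\<integral>b. G b * (norm (k b))\<^sup>2 \<partial>lborel)"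
    using int G0 by (intro nn_integral_eq_integral) auto
  also have "\<dots> \<le> ennreal (norm (complex_of_real (\<integral>b. G b * (norm (k b))\<^sup>2 \<partial>lborel)))"
    by (intro ennreal_leI) simp
  also have "\<dots> \<le> (\<integral>\<^sup>+z. ennreal (norm (w z * of_real (2 * pi * normal_density 0 \<epsilon> (fst z - snd z)))) \<partial>?L)"
  proof (unfold eq, rule integral_norm_bound_ennreal)
    have "integrable ?L (\<lambda>z. \<integral>b. of_real (G b) * (w z * iexp ((fst z - snd z) * b)) \<partial>lborel)"
      using Q.integrable_fst[OF H] by simp
    also have "(\<lambda>z. \<integral>b. of_real (G b) * (w z * iexp ((fst z - snd z) * b)) \<partial>lborel)
       = (\<lambda>z. w z * of_real (2 * pi * normal_density 0 \<epsilon> (fst z - snd z)))"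
      unfolding GF[symmetric] by (subst integral_mult_right_zero[symmetric]) (simp add: mult_ac)
    finally show "integrable ?L (\<lambda>z. w z * of_real (2 * pi * normal_density 0 \<epsilon> (fst z - snd z)))" .
  qed
  \<comment> \<open>The density depends only on the distance of the two frequencies, so in each
    summand it may be centred at the frequency occurring in \<open>m\<close> and then integrated out
    over the other one.\<close>
  also have "\<dots> \<le> (\<integral>\<^sup>+z. ennreal pi * (ennreal ((norm (m (fst z)))\<^sup>2) * ennreal (normal_density (fst z) \<epsilon> (snd z))
                       + ennreal ((norm (m (snd z)))\<^sup>2) * ennreal (normal_density (snd z) \<epsilon> (fst z))) \<partial>?L)"
  proof (rule nn_integral_mono)
    fix z :: "real \<times> real"
    let ?n = "normal_density 0 \<epsilon> (fst z - snd z)"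
    have n: "normal_density (fst z) \<epsilon> (snd z) = ?n" "normal_density (snd z) \<epsilon> (fst z) = ?n"
      by (auto simp: normal_density_def power2_commute)
    have "2 * (norm (m (fst z)) * norm (m (snd z))) \<le> (norm (m (fst z)))\<^sup>2 + (norm (m (snd z)))\<^sup>2"
      using sum_squares_bound[of "norm (m (fst z))" "norm (m (snd z))"] by simp
    then have "pi * ?n * (2 * (norm (m (fst z)) * norm (m (snd z)))) \<le> pi * ?n * ((norm (m (fst z)))\<^sup>2 + (norm (m (snd z)))\<^sup>2)"
      by (intro mult_left_mono) auto
    then have "norm (w z * of_real (2 * pi * ?n)) \<le> pi * ((norm (m (fst z)))\<^sup>2 * ?n + (norm (m (snd z)))\<^sup>2 * ?n)"
      by (simp add: w_def norm_mult algebra_simps)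
    then show "ennreal (norm (w z * of_real (2 * pi * ?n))) \<le> ennreal pi * (ennreal ((norm (m (fst z)))\<^sup>2) * ennreal (normal_density (fst z) \<epsilon> (snd z))
                       + ennreal ((norm (m (snd z)))\<^sup>2) * ennreal (normal_density (snd z) \<epsilon> (fst z)))"
      unfolding n by (simp add: ennreal_mult[symmetric] ennreal_plus[symmetric] del: ennreal_plus)
  qed
  also have "\<dots> = ennreal pi * ((\<integral>\<^sup>+z. ennreal ((norm (m (fst z)))\<^sup>2) * ennreal (normal_density (fst z) \<epsilon> (snd z)) \<partial>?L)
                       + (\<integral>\<^sup>+z. ennreal ((norm (m (snd z)))\<^sup>2) * ennreal (normal_density (snd z) \<epsilon> (fst z)) \<partial>?L))"
    by (simp add: nn_integral_cmult nn_integral_add)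
  also have "(\<integral>\<^sup>+z. ennreal ((norm (m (fst z)))\<^sup>2) * ennreal (normal_density (fst z) \<epsilon> (snd z)) \<partial>?L)
      = (\<integral>\<^sup>+\<xi>. ennreal ((norm (m \<xi>))\<^sup>2) \<partial>lborel)"
    by (subst lborel.nn_integral_fst[symmetric])
       (auto simp: nn_integral_cmult nd1)
  also have "(\<integral>\<^sup>+z. ennreal ((norm (m (snd z)))\<^sup>2) * ennreal (normal_density (snd z) \<epsilon> (fst z)) \<partial>?L)
      = (\<integral>\<^sup>+\<xi>. ennreal ((norm (m \<xi>))\<^sup>2) \<partial>lborel)"
    by (subst lborel_pair.nn_integral_snd[symmetric])
       (auto simp: nn_integral_cmult nd1)
  also have "ennreal pi * ((\<integral>\<^sup>+\<xi>. ennreal ((norm (m \<xi>))\<^sup>2) \<partial>lborel) + (\<integral>\<^sup>+\<xi>. ennreal ((norm (m \<xi>))\<^sup>2) \<partial>lborel))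
     = ennreal (2 * pi) * (\<integral>\<^sup>+\<xi>. ennreal ((norm (m \<xi>))\<^sup>2) \<partial>lborel)"
    by (simp add: ennreal_mult mult_2[symmetric] mult_ac)
  finally show ?thesis by (simp add: G_def)
qed

text \<open>The damped bound is uniform in \<open>\<epsilon>\<close>, so Fatou's lemma along
  \<open>\<epsilon> = 1 / (n + 1)\<close> removes the damping.\<close>

lemma bessel:
  fixes m :: "real \<Rightarrow> complex"
  assumes m: "integrable lborel m"
  defines "k \<equiv> \<lambda>b. \<integral>\<xi>. m \<xi> * iexp (\<xi> * b) \<partial>lborel"
  shows "(\<integral>\<^sup>+b. ennreal ((norm (k b))\<^sup>2) \<partial>lborel)
           \<le> ennreal (2 * pi) * (\<integral>\<^sup>+\<xi>. ennreal ((norm (m \<xi>))\<^sup>2) \<partial>lborel)"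
proof -
  have [measurable]: "m \<in> borel_measurable borel" using m by auto
  have [measurable]: "k \<in> borel_measurable borel" unfolding k_def by measurable
  define u where "u = (\<lambda>(n::nat) b. ennreal (exp (- (1 / real (Suc n) * b)\<^sup>2 / 2) * (norm (k b))\<^sup>2))"
  have lim: "(\<lambda>n. u n b) \<longlonglongrightarrow> ennreal ((norm (k b))\<^sup>2)" for b
  proof -
    have "(\<lambda>n. exp (- (1 / real (Suc n) * b)\<^sup>2 / 2) * (norm (k b))\<^sup>2) \<longlonglongrightarrow> exp (- (0 * b)\<^sup>2 / 2) * (norm (k b))\<^sup>2"
      by (intro tendsto_intros LIMSEQ_Suc[OF lim_inverse_n']) auto
    then show ?thesis unfolding u_def by (intro tendsto_ennrealI) auto
  qed
  have "(\<integral>\<^sup>+b. ennreal ((norm (k b))\<^sup>2) \<partial>lborel) = (\<integral>\<^sup>+b. liminf (\<lambda>n. u n b) \<partial>lborel)"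
    using lim_imp_Liminf[OF _ lim] by simp
  also have "\<dots> \<le> liminf (\<lambda>n. \<integral>\<^sup>+b. u n b \<partial>lborel)"
    by (rule nn_integral_liminf) (simp add: u_def)
  also have "\<dots> \<le> liminf (\<lambda>n::nat. ennreal (2 * pi) * (\<integral>\<^sup>+\<xi>. ennreal ((norm (m \<xi>))\<^sup>2) \<partial>lborel))"
    by (rule Liminf_mono, rule always_eventually, rule allI, unfold u_def k_def, rule bessel_damped[OF m]) auto
  finally show ?thesis by (simp add: Liminf_const)
qed

section \<open>Complex exponentials as integrals of translates of the activation\<close>

lemma norm_iexp_diff_le: "norm (iexp x - iexp y) \<le> \<bar>x - y\<bar>"
proof -
  have "iexp x - iexp y = iexp y * (iexp (x - y) - 1)"
    by (simp add: algebra_simps exp_add[symmetric])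
  then have "norm (iexp x - iexp y) = norm (iexp (x - y) - 1)"
    by (simp add: norm_mult)
  also have "\<dots> \<le> \<bar>x - y\<bar>" using iexp_approx1[of "x - y" 0] by simp
  finally show ?thesis .
qed

text \<open>Both \<open>a\<close> and \<open>K\<close> are fixed before \<open>l\<close>, because
  they go into the final constant. The supremum of \<open>k\<close> may depend on \<open>l\<close>:
  it only certifies integrability, while the size of the kernel is measured in L2.\<close>

lemma ridge_exponential:
  fixes s :: "real \<Rightarrow> real"
  assumes s: "integrable lborel s" and nz: "\<not> (AE x in lborel. s x = 0)"
  obtains a K where "a \<noteq> 0" "K \<ge> 0"
    "\<And>l. l \<ge> 1 \<Longrightarrow> \<exists>k\<in>borel_measurable borel. (\<exists>B. \<forall>b. norm (k b) \<le> B) \<and>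
        (\<integral>\<^sup>+b. ennreal ((norm (k b))\<^sup>2) \<partial>lborel) \<le> ennreal (K * l) \<and>
        (\<forall>t. norm ((\<integral>b. s (t + b) *\<^sub>R k b \<partial>lborel) - iexp (- (a * t))) \<le> \<bar>t\<bar> / l)"
proof -
  have [measurable]: "s \<in> borel_measurable borel" using s by auto
  define S where "S = (\<lambda>\<xi>. \<integral>x. s x *\<^sub>R iexp (\<xi> * x) \<partial>lborel)"
  obtain a \<delta>' c where a: "a \<noteq> 0" and \<delta>': "\<delta>' > 0" and c: "c > 0"
    and lower': "\<And>\<xi>. \<bar>\<xi> - a\<bar> \<le> \<delta>' \<Longrightarrow> c \<le> norm (S \<xi>)"
    using fourier_L1_lower_bound[OF s nz] unfolding S_def by metis
  \<comment> \<open>Capping at 1 makes the half-width \<open>\<delta> / l\<close> of the window at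
    most \<open>1 / l\<close>, so that the error is \<open>|t| / l\<close> without a further
    constant.\<close>
  define \<delta> where "\<delta> = min \<delta>' 1"
  have \<delta>: "\<delta> > 0" "\<delta> \<le> 1" and lower: "\<And>\<xi>. \<bar>\<xi> - a\<bar> \<le> \<delta> \<Longrightarrow> c \<le> norm (S \<xi>)"
    using \<delta>' lower' by (auto simp: \<delta>_def)
  have [measurable]: "S \<in> borel_measurable borel" unfolding S_def by measurable
  show ?thesis
  \<comment> \<open>On a window of length \<open>2 * \<eta>\<close> with
    \<open>\<eta> = \<delta> / l\<close> the function \<open>m\<close> has modulus at most
    \<open>1 / (2 * \<eta> * c)\<close>. Bessel's inequality then gives \<open>2 * pi * (2 * \<eta>)
    / (2 * \<eta> * c)^2 = pi / (\<eta> * c^2)\<close>, which is the given constant times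
    \<open>l\<close>.\<close>
  proof (rule that[of a "pi / (\<delta> * c\<^sup>2)"])
    fix l :: real assume l: "l \<ge> 1"
    \<comment> \<open>The kernel is the inverse Fourier transform of \<open>1 / S\<close>, averaged over a window of width \<open>2 \<delta> / l\<close>
      around \<open>a\<close>. Averaging turns \<open>iexp (- (a * t))\<close> into its mean over the window, and the shorter the
      window, the better the approximation but the larger the \<open>L\<^sup>2\<close> norm of the kernel.\<close>
    define \<eta> where "\<eta> = \<delta> / l"
    have \<eta>: "\<eta> > 0" "\<eta> \<le> \<delta>" "\<eta> \<le> 1 / l" using \<delta> l by (auto simp: \<eta>_def field_simps)
    define J where "J = {a - \<eta> .. a + \<eta>}"
    have JI[measurable]: "J \<in> sets borel" and mJ: "emeasure lborel J = ennreal (2 * \<eta>)" and mJ': "measure lborel J = 2 * \<eta>"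
      using \<eta> by (auto simp: J_def)
    have iJ: "integrable lborel (\<lambda>\<xi>. indicator J \<xi> *\<^sub>R (z::complex))" for z
      using mJ by (intro integrable_indicator) auto
    define m where "m = (\<lambda>\<xi>. indicator J \<xi> *\<^sub>R (1 / (2 * \<eta>) / S \<xi>))"
    have SJ: "c \<le> norm (S \<xi>)" "S \<xi> \<noteq> 0" if "\<xi> \<in> J" for \<xi>
    proof -
      show "c \<le> norm (S \<xi>)" using that \<eta>(2) by (intro lower) (auto simp: J_def)
      then show "S \<xi> \<noteq> 0" using c by auto
    qed
    have mb: "norm (m \<xi>) \<le> norm (indicator J \<xi> *\<^sub>R complex_of_real (1 / (2 * \<eta> * c)))" for \<xi>
      using SJ[of \<xi>] c \<eta> by (auto simp: m_def indicator_def norm_divide norm_mult field_simps)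
    have mint: "integrable lborel m"
      by (rule Bochner_Integration.integrable_bound[OF iJ]) (use mb in \<open>auto simp: m_def\<close>)
    have [measurable]: "m \<in> borel_measurable borel" using mint by auto
    define k where "k = (\<lambda>b. \<integral>\<xi>. m \<xi> * iexp (\<xi> * b) \<partial>lborel)"
    have kint: "integrable lborel (\<lambda>\<xi>. m \<xi> * iexp (\<xi> * b))" for b
      by (rule Bochner_Integration.integrable_bound[OF mint]) (auto simp: norm_mult)
    have kb: "norm (k b) \<le> (\<integral>\<xi>. norm (m \<xi>) \<partial>lborel)" for b
      unfolding k_def using integral_norm_bound[of lborel "\<lambda>\<xi>. m \<xi> * iexp (\<xi> * b)"] by (simp add: norm_mult)
    have kL2: "(\<integral>\<^sup>+b. ennreal ((norm (k b))\<^sup>2) \<partial>lborel) \<le> ennreal (pi / (\<delta> * c\<^sup>2) * l)"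
    proof -
      have "(\<integral>\<^sup>+b. ennreal ((norm (k b))\<^sup>2) \<partial>lborel) \<le> ennreal (2 * pi) * (\<integral>\<^sup>+\<xi>. ennreal ((norm (m \<xi>))\<^sup>2) \<partial>lborel)"
        unfolding k_def by (rule bessel[OF mint])
      also have "(\<integral>\<^sup>+\<xi>. ennreal ((norm (m \<xi>))\<^sup>2) \<partial>lborel) \<le> (\<integral>\<^sup>+\<xi>. ennreal ((1 / (2 * \<eta> * c))\<^sup>2) * indicator J \<xi> \<partial>lborel)"
      proof (rule nn_integral_mono)
        fix \<xi>
        have "(norm (m \<xi>))\<^sup>2 \<le> (1 / (2 * \<eta> * c))\<^sup>2" if "\<xi> \<in> J"
          using mb[of \<xi>] that c \<eta> by (intro power_mono) (auto simp: norm_divide norm_mult)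
        then show "ennreal ((norm (m \<xi>))\<^sup>2) \<le> ennreal ((1 / (2 * \<eta> * c))\<^sup>2) * indicator J \<xi>"
          by (auto simp: indicator_def m_def intro!: ennreal_leI)
      qed
      also have "\<dots> = ennreal ((1 / (2 * \<eta> * c))\<^sup>2) * ennreal (2 * \<eta>)"
        by (simp add: nn_integral_cmult_indicator mJ)
      also have "ennreal (2 * pi) * (ennreal ((1 / (2 * \<eta> * c))\<^sup>2) * ennreal (2 * \<eta>)) = ennreal (2 * pi * ((1 / (2 * \<eta> * c))\<^sup>2 * (2 * \<eta>)))"
      proof -
        have "ennreal x * (ennreal y * ennreal z) = ennreal (x * (y * z))" if "0 \<le> x" "0 \<le> y" "0 \<le> z" for x y z
          using that by (simp add: ennreal_mult)
        then show ?thesis using \<eta> by (meson less_imp_le mult_nonneg_nonneg pi_ge_zero zero_le_numeral zero_le_power2)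
      qed
      also have "2 * pi * ((1 / (2 * \<eta> * c))\<^sup>2 * (2 * \<eta>)) = pi / (\<delta> * c\<^sup>2) * l"
        using \<eta> c \<delta> l by (simp add: \<eta>_def field_simps power2_eq_square)
      finally show ?thesis by (simp add: mult_left_mono)
    qed
    have rep: "norm ((\<integral>b. s (t + b) *\<^sub>R k b \<partial>lborel) - iexp (- (a * t))) \<le> \<bar>t\<bar> / l" for t
    proof -
      have st: "integrable lborel (\<lambda>b. s (t + b))"
        using lborel_integrable_real_affine[OF s, of 1 t] by (simp add: add.commute)
      have H: "integrable (lborel \<Otimes>\<^sub>M lborel) (\<lambda>(\<xi>, b). m \<xi> * (complex_of_real (s (t + b)) * iexp (\<xi> * b)))"
      proof (rule Bochner_Integration.integrable_bound)
        show "integrable (lborel \<Otimes>\<^sub>M lborel) (\<lambda>z. m (fst z) * of_real (s (t + snd z)))"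
          using mint st by (intro integrable_mult_fst_snd sigma_finite_lborel) auto
      qed (auto simp: norm_mult split_beta)
      \<comment> \<open>Translating \<open>s\<close> by \<open>t\<close> multiplies its transform by
        a phase. The remaining factor \<open>S \<xi>\<close> cancels the reciprocal in
        \<open>m\<close> and leaves the average of \<open>iexp (- (\<xi> * t))\<close> over the
        window.\<close>
      have shift: "(\<integral>b. complex_of_real (s (t + b)) * iexp (\<xi> * b) \<partial>lborel) = iexp (- (\<xi> * t)) * S \<xi>" for \<xi>
      proof -
        have "S \<xi> = (\<integral>b. s (t + 1 * b) *\<^sub>R iexp (\<xi> * (t + 1 * b)) \<partial>lborel)"
          unfolding S_def using lborel_integral_real_affine[of 1 "\<lambda>x. s x *\<^sub>R iexp (\<xi> * x)" t] by simp
        also have "\<dots> = (\<integral>b. iexp (\<xi> * t) * (complex_of_real (s (t + b)) * iexp (\<xi> * b)) \<partial>lborel)"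
          by (rule Bochner_Integration.integral_cong) (auto simp: scaleR_conv_of_real exp_add ring_distribs)
        also have "\<dots> = iexp (\<xi> * t) * (\<integral>b. complex_of_real (s (t + b)) * iexp (\<xi> * b) \<partial>lborel)"
          by (rule integral_mult_right_zero)
        finally show ?thesis
          by (simp add: mult.assoc[symmetric] exp_add[symmetric])
      qed
      have "(\<integral>b. s (t + b) *\<^sub>R k b \<partial>lborel)
          = (\<integral>b. \<integral>\<xi>. m \<xi> * (complex_of_real (s (t + b)) * iexp (\<xi> * b)) \<partial>lborel \<partial>lborel)"
      proof (rule Bochner_Integration.integral_cong[OF refl])
        fix b
        have "s (t + b) *\<^sub>R k b = (\<integral>\<xi>. complex_of_real (s (t + b)) * (m \<xi> * iexp (\<xi> * b)) \<partial>lborel)"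
          unfolding k_def scaleR_conv_of_real by (rule integral_mult_right_zero[symmetric])
        then show "s (t + b) *\<^sub>R k b = (\<integral>\<xi>. m \<xi> * (complex_of_real (s (t + b)) * iexp (\<xi> * b)) \<partial>lborel)"
          by (simp add: mult_ac)
      qed
      also have "\<dots> = (\<integral>\<xi>. \<integral>b. m \<xi> * (complex_of_real (s (t + b)) * iexp (\<xi> * b)) \<partial>lborel \<partial>lborel)"
        by (rule lborel_pair.Fubini_integral[OF H])
      also have "\<dots> = (\<integral>\<xi>. m \<xi> * (iexp (- (\<xi> * t)) * S \<xi>) \<partial>lborel)"
        by (simp only: integral_mult_right_zero shift)
      also have "\<dots> = (\<integral>\<xi>. indicator J \<xi> *\<^sub>R (1 / (2 * \<eta>) * iexp (- (\<xi> * t))) \<partial>lborel)"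
        using SJ by (intro Bochner_Integration.integral_cong) (auto simp: m_def indicator_def field_simps)
      finally have e1: "(\<integral>b. s (t + b) *\<^sub>R k b \<partial>lborel) = (\<integral>\<xi>. indicator J \<xi> *\<^sub>R (1 / (2 * \<eta>) * iexp (- (\<xi> * t))) \<partial>lborel)" .
      have e2: "iexp (- (a * t)) = (\<integral>\<xi>. indicator J \<xi> *\<^sub>R (1 / (2 * \<eta>) * iexp (- (a * t))) \<partial>lborel)"
        using \<eta> mJ' mJ by (subst integral_scaleR_left) (auto simp: scaleR_conv_of_real)
      have i1: "integrable lborel (\<lambda>\<xi>. indicator J \<xi> *\<^sub>R (1 / (2 * \<eta>) * iexp (- (\<xi> * t))))"
        by (rule Bochner_Integration.integrable_bound[OF iJ[of "1 / (2 * \<eta>)"]]) (auto simp: norm_divide norm_exp_eq_Re indicator_def)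
      have "norm ((\<integral>b. s (t + b) *\<^sub>R k b \<partial>lborel) - iexp (- (a * t)))
         = norm (\<integral>\<xi>. indicator J \<xi> *\<^sub>R (1 / (2 * \<eta>) * iexp (- (\<xi> * t))) - indicator J \<xi> *\<^sub>R (1 / (2 * \<eta>) * iexp (- (a * t))) \<partial>lborel)"
        unfolding e1 by (subst e2, subst Bochner_Integration.integral_diff[OF i1 iJ]) simp
      also have "\<dots> \<le> (\<integral>\<xi>. indicator J \<xi> *\<^sub>R (\<bar>t\<bar> / 2) \<partial>lborel)"
      proof (rule Bochner_Integration.integral_norm_bound_integral)
        show "integrable lborel (\<lambda>\<xi>. indicator J \<xi> *\<^sub>R (\<bar>t\<bar> / 2))"
          using mJ by (intro integrable_indicator) auto
        show "norm (indicator J \<xi> *\<^sub>R (1 / (2 * \<eta>) * iexp (- (\<xi> * t))) - indicator J \<xi> *\<^sub>R (1 / (2 * \<eta>) * iexp (- (a * t))))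
            \<le> indicator J \<xi> *\<^sub>R (\<bar>t\<bar> / 2)" for \<xi>
        proof (cases "\<xi> \<in> J")
          case True
          have "norm (iexp (- (\<xi> * t)) - iexp (- (a * t))) \<le> \<bar>- (\<xi> * t) - - (a * t)\<bar>"
            by (rule norm_iexp_diff_le)
          also have "\<dots> = \<bar>\<xi> - a\<bar> * \<bar>t\<bar>" by (simp add: abs_mult[symmetric] algebra_simps abs_minus_commute)
          also have "\<dots> \<le> \<eta> * \<bar>t\<bar>" using True by (intro mult_right_mono) (auto simp: J_def)
          finally have "1 / (2 * \<eta>) * norm (iexp (- (\<xi> * t)) - iexp (- (a * t))) \<le> 1 / (2 * \<eta>) * (\<eta> * \<bar>t\<bar>)"
            using \<eta> by (intro mult_left_mono) auto
          moreover have "norm (1 / (2 * \<eta>) * iexp (- (\<xi> * t)) - 1 / (2 * \<eta>) * iexp (- (a * t)))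
               = 1 / (2 * \<eta>) * norm (iexp (- (\<xi> * t)) - iexp (- (a * t)))"
            using \<eta> unfolding right_diff_distrib[symmetric] norm_mult by (simp add: norm_divide norm_mult)
          ultimately show ?thesis using True \<eta> by simp
        qed simp
      qed (use i1 iJ in \<open>auto intro!: Bochner_Integration.integrable_diff\<close>)
      also have "\<dots> = \<eta> * \<bar>t\<bar>" using mJ mJ' by (subst integral_scaleR_left) auto
      also have "\<dots> \<le> 1 / l * \<bar>t\<bar>" using \<eta> by (intro mult_right_mono) auto
      finally show ?thesis by simp
    qed
    have "k \<in> borel_measurable borel" unfolding k_def by measurable
    then show "\<exists>k\<in>borel_measurable borel. (\<exists>B. \<forall>b. norm (k b) \<le> B) \<and>
        (\<integral>\<^sup>+b. ennreal ((norm (k b))\<^sup>2) \<partial>lborel) \<le> ennreal (pi / (\<delta> * c\<^sup>2) * l) \<and>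
        (\<forall>t. norm ((\<integral>b. s (t + b) *\<^sub>R k b \<partial>lborel) - iexp (- (a * t))) \<le> \<bar>t\<bar> / l)"
      using kb kL2 rep by blast
  qed (use a \<delta> c in auto)
qed

section \<open>Monte Carlo approximation in \<open>L\<^sup>2\<close>\<close>

text \<open>First-moment argument with a side condition: points violating \<open>Q\<close> form a
  null set, so \<open>h > T\<close> at all the others would push the mean of \<open>h\<close>
  strictly above the finite value \<open>T\<close>. Later \<open>Q\<close> says that a neuron built
  from \<open>\<sigma>\<close> agrees almost everywhere with the one built from
  \<open>s\<close>.\<close>

lemma exists_le_nn_integral:
  assumes M: "prob_space M"
    and h[measurable]: "h \<in> borel_measurable M" and le: "(\<integral>\<^sup>+\<theta>. h \<theta> \<partial>M) \<le> T" and T: "T < \<infinity>"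
    and Q: "AE \<theta> in M. Q \<theta>"
  shows "\<exists>\<theta>\<in>space M. Q \<theta> \<and> h \<theta> \<le> T"
proof (rule ccontr)
  interpret prob_space M by fact
  assume neg: "\<not> ?thesis"
  have gt: "AE \<theta> in M. T < h \<theta>"
    by (rule AE_mp[OF Q]) (rule AE_I2, use neg in \<open>auto simp: not_le\<close>)
  have "(\<integral>\<^sup>+\<theta>. T \<partial>M) < (\<integral>\<^sup>+\<theta>. h \<theta> \<partial>M)"
  proof (rule nn_integral_less)
    show "\<not> (AE x in M. h x \<le> T)"
    proof
      assume "AE x in M. h x \<le> T"
      with gt have "AE x in M. False" by eventually_elim simp
      then show False by simp
    qed
  qed (use T gt in \<open>auto simp: emeasure_space_1 intro: less_imp_le elim!: AE_mp\<close>)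
  then show False using le by (simp add: emeasure_space_1)
qed

text \<open>
  The points are chosen one at a time: on average a new point adds at most its own variance to the
  squared error, since the cross term has mean zero.
\<close>

lemma monte_carlo_L2:
  fixes V :: "'a \<Rightarrow> 'b \<Rightarrow> real"
  assumes M: "prob_space M" and N: "finite_measure N"
    and V[measurable]: "(\<lambda>(\<theta>, x). V \<theta> x) \<in> borel_measurable (M \<Otimes>\<^sub>M N)"
    and S: "S \<ge> 0"
    and V2: "\<And>x. x \<in> space N \<Longrightarrow> (\<integral>\<^sup>+\<theta>. ennreal ((V \<theta> x)\<^sup>2) \<partial>M) \<le> ennreal S"
    and Q: "AE \<theta> in M. Q \<theta>"
    and n: "n > 0"
  shows "\<exists>\<theta>. (\<forall>i<n. \<theta> i \<in> space M \<and> Q (\<theta> i)) \<and>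
    (\<integral>\<^sup>+x. ennreal (((\<Sum>i<n. V (\<theta> i) x) / real n - (\<integral>\<theta>. V \<theta> x \<partial>M))\<^sup>2) \<partial>N)
      \<le> ennreal (S * measure N (space N) / real n)"
proof -
  interpret prob_space M by fact
  interpret N: finite_measure N by fact
  interpret MN: pair_sigma_finite M N ..
  define F where "F = (\<lambda>x. \<integral>\<theta>. V \<theta> x \<partial>M)"
  have [measurable]: "F \<in> borel_measurable N" unfolding F_def by measurable
  have V2int: "integrable M (\<lambda>\<theta>. (V \<theta> x)\<^sup>2)" and Vint: "integrable M (\<lambda>\<theta>. V \<theta> x)"
    and V2le: "(\<integral>\<theta>. (V \<theta> x)\<^sup>2 \<partial>M) \<le> S" if x: "x \<in> space N" for x
  proof -
    have [measurable]: "(\<lambda>\<theta>. V \<theta> x) \<in> borel_measurable M" using x by measurable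
    show i2: "integrable M (\<lambda>\<theta>. (V \<theta> x)\<^sup>2)"
      using V2[OF x] by (intro integrableI_bounded) (auto intro: le_less_trans)
    show "integrable M (\<lambda>\<theta>. V \<theta> x)"
      by (rule square_integrable_imp_integrable[OF _ i2]) auto
    show "(\<integral>\<theta>. (V \<theta> x)\<^sup>2 \<partial>M) \<le> S"
      using V2[OF x] nn_integral_eq_integral[OF i2] S by simp
  qed
  \<comment> \<open>The exact value is \<open>g^2\<close> plus the variance of \<open>V\<close>;
    dropping \<open>- (F x)^2\<close> leaves the second moment, which \<open>S\<close>
    bounds.\<close>
  have step: "(\<integral>\<^sup>+\<theta>. ennreal ((g + (V \<theta> x - F x))\<^sup>2) \<partial>M) \<le> ennreal (g\<^sup>2) + ennreal S"
    if x: "x \<in> space N" for g x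
  proof -
    have eq: "(g + (V \<theta> x - F x))\<^sup>2 = (V \<theta> x)\<^sup>2 + (2 * (g - F x) * V \<theta> x + (g - F x)\<^sup>2)" for \<theta>
      by (simp add: power2_eq_square algebra_simps)
    have i: "integrable M (\<lambda>\<theta>. (g + (V \<theta> x - F x))\<^sup>2)"
      unfolding eq using V2int[OF x] Vint[OF x] by auto
    have "(\<integral>\<theta>. (g + (V \<theta> x - F x))\<^sup>2 \<partial>M) = (\<integral>\<theta>. (V \<theta> x)\<^sup>2 \<partial>M) + (2 * (g - F x) * F x + (g - F x)\<^sup>2)"
      unfolding eq using V2int[OF x] Vint[OF x] by (simp add: F_def prob_space)
    also have "\<dots> = (\<integral>\<theta>. (V \<theta> x)\<^sup>2 \<partial>M) + g\<^sup>2 - (F x)\<^sup>2"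
      by (simp add: power2_eq_square algebra_simps)
    also have "\<dots> \<le> S + g\<^sup>2" using V2le[OF x] zero_le_power2[of "F x"] by linarith
    finally have "(\<integral>\<theta>. (g + (V \<theta> x - F x))\<^sup>2 \<partial>M) \<le> g\<^sup>2 + S" by simp
    then show ?thesis
      using nn_integral_eq_integral[OF i] S by (simp add: ennreal_plus[symmetric] ennreal_leI del: ennreal_plus)
  qed
  \<comment> \<open>The induction runs on the unnormalised sum of deviations, whose squared norm
    grows at most linearly in the number of points. Dividing by \<open>n^2\<close> at the end yields
    the factor \<open>1 / n\<close>.\<close>
  have main: "\<exists>\<theta>. (\<forall>i<k. \<theta> i \<in> space M \<and> Q (\<theta> i)) \<and>
    (\<integral>\<^sup>+x. ennreal ((\<Sum>i<k. V (\<theta> i) x - F x)\<^sup>2) \<partial>N) \<le> ennreal (real k * (S * measure N (space N)))" for k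
  proof (induction k)
    case 0
    then show ?case by auto
  next
    case (Suc k)
    then obtain \<theta> where \<theta>: "\<And>i. i < k \<Longrightarrow> \<theta> i \<in> space M \<and> Q (\<theta> i)"
      and le: "(\<integral>\<^sup>+x. ennreal ((\<Sum>i<k. V (\<theta> i) x - F x)\<^sup>2) \<partial>N) \<le> ennreal (real k * (S * measure N (space N)))"
      by blast
    define g where "g = (\<lambda>x. \<Sum>i<k. V (\<theta> i) x - F x)"
    have [measurable]: "g \<in> borel_measurable N"
      unfolding g_def
    proof (intro borel_measurable_sum borel_measurable_diff)
      fix i assume "i \<in> {..<k}"
      then have "\<theta> i \<in> space M" using \<theta> by auto
      then show "V (\<theta> i) \<in> borel_measurable N" using measurable_compose[OF measurable_Pair1' V] by simp
    qed measurable
    have "(\<integral>\<^sup>+\<theta>. (\<integral>\<^sup>+x. ennreal ((g x + (V \<theta> x - F x))\<^sup>2) \<partial>N) \<partial>M)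
        = (\<integral>\<^sup>+x. (\<integral>\<^sup>+\<theta>. ennreal ((g x + (V \<theta> x - F x))\<^sup>2) \<partial>M) \<partial>N)"
      by (rule MN.Fubini'[symmetric]) measurable
    also have "\<dots> \<le> (\<integral>\<^sup>+x. ennreal ((g x)\<^sup>2) + ennreal S \<partial>N)"
      by (rule nn_integral_mono) (rule step)
    also have "\<dots> = (\<integral>\<^sup>+x. ennreal ((g x)\<^sup>2) \<partial>N) + ennreal S * emeasure N (space N)"
      by (subst nn_integral_add) auto
    also have "\<dots> \<le> ennreal (real k * (S * measure N (space N))) + ennreal S * emeasure N (space N)"
      using le unfolding g_def by (rule add_right_mono)
    also have "\<dots> = ennreal (real (Suc k) * (S * measure N (space N)))"
      using S by (simp add: N.emeasure_eq_measure ennreal_mult[symmetric] ennreal_plus[symmetric] algebra_simps del: ennreal_plus)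
    finally have "\<exists>\<theta>'\<in>space M. Q \<theta>' \<and> (\<integral>\<^sup>+x. ennreal ((g x + (V \<theta>' x - F x))\<^sup>2) \<partial>N)
        \<le> ennreal (real (Suc k) * (S * measure N (space N)))"
      by (intro exists_le_nn_integral[OF M]) (use Q in auto)
    then obtain \<theta>' where \<theta>': "\<theta>' \<in> space M" "Q \<theta>'"
      "(\<integral>\<^sup>+x. ennreal ((g x + (V \<theta>' x - F x))\<^sup>2) \<partial>N) \<le> ennreal (real (Suc k) * (S * measure N (space N)))"
      by blast
    have "(\<Sum>i<Suc k. V ((\<theta>(k := \<theta>')) i) x - F x) = g x + (V \<theta>' x - F x)" for x
      by (simp add: g_def)
    then show ?case using \<theta> \<theta>' by (intro exI[of _ "\<theta>(k := \<theta>')"]) (auto simp: less_Suc_eq)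
  qed
  obtain \<theta> where \<theta>: "\<And>i. i < n \<Longrightarrow> \<theta> i \<in> space M \<and> Q (\<theta> i)"
    and le: "(\<integral>\<^sup>+x. ennreal ((\<Sum>i<n. V (\<theta> i) x - F x)\<^sup>2) \<partial>N) \<le> ennreal (real n * (S * measure N (space N)))"
    using main[of n] by blast
  have [measurable]: "(\<lambda>x. (\<Sum>i<n. V (\<theta> i) x - F x)) \<in> borel_measurable N"
  proof (intro borel_measurable_sum borel_measurable_diff)
    fix i assume "i \<in> {..<n}"
    then have "\<theta> i \<in> space M" using \<theta> by auto
    then show "V (\<theta> i) \<in> borel_measurable N" using measurable_compose[OF measurable_Pair1' V] by simp
  qed measurable
  have "((\<Sum>i<n. V (\<theta> i) x) / real n - F x)\<^sup>2 = 1 / (real n)\<^sup>2 * (\<Sum>i<n. V (\<theta> i) x - F x)\<^sup>2" for x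
    using n by (simp add: sum_subtractf power2_eq_square field_simps)
  then have "(\<integral>\<^sup>+x. ennreal (((\<Sum>i<n. V (\<theta> i) x) / real n - F x)\<^sup>2) \<partial>N)
     = ennreal (1 / (real n)\<^sup>2) * (\<integral>\<^sup>+x. ennreal ((\<Sum>i<n. V (\<theta> i) x - F x)\<^sup>2) \<partial>N)"
    by (subst nn_integral_cmult[symmetric]) (auto simp: ennreal_mult[symmetric])
  also have "\<dots> \<le> ennreal (1 / (real n)\<^sup>2) * ennreal (real n * (S * measure N (space N)))"
    using le by (rule mult_left_mono) simp
  also have "\<dots> = ennreal (1 / (real n)\<^sup>2 * (real n * (S * measure N (space N))))"
    using S by (intro ennreal_mult[symmetric]) auto
  also have "1 / (real n)\<^sup>2 * (real n * (S * measure N (space N))) = S * measure N (space N) / real n"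
    using n by (simp add: power2_eq_square)
  finally show ?thesis using \<theta> unfolding F_def by blast
qed

section \<open>Fourier inversion for tempered functions\<close>

lemma norm_poly_le:
  fixes p :: "complex poly"
  shows "\<exists>C\<ge>0. \<exists>n. \<forall>z. norm (poly p z) \<le> C * (1 + norm z) ^ n"
proof (induction p)
  case 0
  then show ?case by (intro exI[of _ 0]) auto
next
  case (pCons a p)
  then obtain C n where C: "C \<ge> 0" "\<And>z. norm (poly p z) \<le> C * (1 + norm z) ^ n" by auto
  have "norm (poly (pCons a p) z) \<le> (norm a + C) * (1 + norm z) ^ Suc n" for z
  proof -
    have "norm (poly (pCons a p) z) \<le> norm a + norm z * norm (poly p z)"
      by (simp add: norm_triangle_le norm_mult)
    also have "\<dots> \<le> norm a * (1 + norm z) ^ Suc n + (1 + norm z) * (C * (1 + norm z) ^ n)"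
      using C(2)[of z] mult_left_mono[OF one_le_power[of "1 + norm z" "Suc n"], of "norm a"]
      by (intro add_mono mult_mono) auto
    finally show ?thesis by (simp add: algebra_simps)
  qed
  then show ?case using C(1) by (intro exI[of _ "norm a + C"]) (metis add_nonneg_nonneg norm_ge_zero)
qed

text \<open>Combines \<open>u^n \<le> n! exp u\<close>, one term of the exponential series, with
  \<open>|t| - c t^2 \<le> 1 / (4 c)\<close>, obtained by completing the square.\<close>

lemma power_mult_gaussian_bounded:
  fixes c :: real
  assumes "c > 0"
  shows "(1 + \<bar>t\<bar>) ^ n * exp (- (c * t\<^sup>2)) \<le> fact n * exp (1 + 1 / (4 * c))"
proof -
  have "(1 + \<bar>t\<bar>) ^ n / fact n \<le> exp (1 + \<bar>t\<bar>)"
    using sum_le_suminf[OF summable_exp_generic[of "1 + \<bar>t\<bar>"], of "{n}"]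
    by (simp add: exp_def divide_inverse mult.commute)
  then have "(1 + \<bar>t\<bar>) ^ n \<le> fact n * exp (1 + \<bar>t\<bar>)" by (simp add: field_simps)
  then have "(1 + \<bar>t\<bar>) ^ n * exp (- (c * t\<^sup>2)) \<le> fact n * exp (1 + \<bar>t\<bar>) * exp (- (c * t\<^sup>2))"
    by (rule mult_right_mono) simp
  also have "\<dots> = fact n * exp (1 + \<bar>t\<bar> - c * t\<^sup>2)"
    by (simp add: exp_add[symmetric])
  also have "\<dots> \<le> fact n * exp (1 + 1 / (4 * c))"
  proof -
    have "0 \<le> (2 * c * \<bar>t\<bar> - 1)\<^sup>2" by simp
    then have "4 * c * \<bar>t\<bar> \<le> 4 * c * (c * t\<^sup>2) + 1"
      by (simp add: power2_eq_square algebra_simps)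
    then have "\<bar>t\<bar> - c * t\<^sup>2 \<le> 1 / (4 * c)" using assms by (simp add: field_simps)
    then show ?thesis by simp
  qed
  finally show ?thesis .
qed

lemma continuous_map_prod_normed_algebra:
  fixes f :: "'i \<Rightarrow> 'a \<Rightarrow> 'b::{real_normed_algebra, comm_ring_1}"
  assumes "\<And>i. i \<in> I \<Longrightarrow> continuous_map X euclidean (f i)"
  shows "continuous_map X euclidean (\<lambda>x. \<Prod>i\<in>I. f i x)"
  using assms
  by (induction I rule: infinite_finite_induct)
     (auto simp: continuous_map_atin limitin_canonical_iff intro!: tendsto_mult)

text \<open>Hermite-type polynomials: differentiating \<open>p(z) exp (- c z^2 + y z)\<close>
  replaces \<open>p\<close> by \<open>p' + (y - 2 c z) p\<close>. A modulation of real frequency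
  corresponds to an imaginary \<open>y\<close>.\<close>

primrec gauss_poly :: "complex \<Rightarrow> complex \<Rightarrow> nat \<Rightarrow> complex poly" where
  "gauss_poly c y 0 = 1"
| "gauss_poly c y (Suc k) = pderiv (gauss_poly c y k) + [:y, - (2 * c):] * gauss_poly c y k"

definition gauss_deriv :: "real \<Rightarrow> real \<Rightarrow> nat \<Rightarrow> real \<Rightarrow> complex" where
  "gauss_deriv c y k t =
     poly (gauss_poly c (\<i> * y) k) (of_real t) * exp (- (of_real c * (of_real t)\<^sup>2) + \<i> * of_real y * of_real t)"

lemma gauss_deriv_0: "gauss_deriv c y 0 t = of_real (exp (- (c * t\<^sup>2))) * iexp (y * t)"
  by (simp add: gauss_deriv_def exp_add[symmetric] exp_of_real[symmetric] mult_ac)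

lemma has_vector_derivative_gauss_deriv:
  "(gauss_deriv c y k has_vector_derivative gauss_deriv c y (Suc k) t) (at t)"
proof -
  have "((\<lambda>z. poly (gauss_poly c (\<i> * y) k) z * exp (- (of_real c * z\<^sup>2) + \<i> * of_real y * z))
     has_field_derivative gauss_deriv c y (Suc k) t) (at (of_real t))"
    unfolding gauss_deriv_def
    by (rule derivative_eq_intros refl poly_DERIV)+ (simp add: algebra_simps)
  from has_vector_derivative_real_field[OF this] show ?thesis
    unfolding gauss_deriv_def[abs_def] by simp
qed

lemma gauss_deriv_bounded:
  assumes c: "c > 0"
  shows "\<exists>B. \<forall>t. (1 + \<bar>t\<bar>) ^ N * norm (gauss_deriv c y k t) \<le> B"
proof -
  obtain C n where C: "C \<ge> 0" "\<And>z. norm (poly (gauss_poly c (\<i> * y) k) z) \<le> C * (1 + norm z) ^ n"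
    using norm_poly_le by blast
  have "(1 + \<bar>t\<bar>) ^ N * norm (gauss_deriv c y k t) \<le> C * (fact (N + n) * exp (1 + 1 / (4 * c)))" for t
  proof -
    have "norm (gauss_deriv c y k t) = norm (poly (gauss_poly c (\<i> * y) k) (of_real t)) * exp (- (c * t\<^sup>2))"
      by (simp add: gauss_deriv_def norm_mult)
    also have "\<dots> \<le> C * (1 + \<bar>t\<bar>) ^ n * exp (- (c * t\<^sup>2))"
      using C(2)[of "of_real t"] by (intro mult_right_mono) auto
    finally have "(1 + \<bar>t\<bar>) ^ N * norm (gauss_deriv c y k t) \<le> (1 + \<bar>t\<bar>) ^ N * (C * (1 + \<bar>t\<bar>) ^ n * exp (- (c * t\<^sup>2)))"
      by (intro mult_left_mono) auto
    also have "\<dots> = C * ((1 + \<bar>t\<bar>) ^ (N + n) * exp (- (c * t\<^sup>2)))"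
      by (simp add: power_add)
    also have "\<dots> \<le> C * (fact (N + n) * exp (1 + 1 / (4 * c)))"
      by (intro mult_left_mono power_mult_gaussian_bounded c C)
    finally show ?thesis .
  qed
  then show ?thesis by blast
qed

lemma enorm_nonneg: "0 \<le> enorm d x"
  by (simp add: enorm_def L2_set_nonneg)

text \<open>Trades the radial weight in the definition of Schwartz and tempered functions for a
  product weight, so that decay in \<open>d\<close> variables can be checked one coordinate at a
  time.\<close>

lemma one_plus_enorm_le_prod: "1 + enorm d x \<le> (\<Prod>i<d. 1 + \<bar>x i\<bar>)"
proof -
  have "enorm d x \<le> (\<Sum>i<d. \<bar>x i\<bar>)" unfolding enorm_def by (rule L2_set_le_sum_abs)
  moreover have "1 + (\<Sum>i<d. \<bar>x i\<bar>) \<le> (\<Prod>i<d. 1 + \<bar>x i\<bar>)"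
  proof (induction d)
    case (Suc d)
    have "0 \<le> \<bar>x d\<bar> * (\<Sum>i<d. \<bar>x i\<bar>)" by (intro mult_nonneg_nonneg sum_nonneg) auto
    moreover have "(1 + (\<Sum>i<d. \<bar>x i\<bar>)) * (1 + \<bar>x d\<bar>) \<le> (\<Prod>i<d. 1 + \<bar>x i\<bar>) * (1 + \<bar>x d\<bar>)"
      using Suc by (rule mult_right_mono) simp
    moreover have "(1 + (\<Sum>i<d. \<bar>x i\<bar>)) * (1 + \<bar>x d\<bar>)
        = 1 + ((\<Sum>i<d. \<bar>x i\<bar>) + \<bar>x d\<bar>) + \<bar>x d\<bar> * (\<Sum>i<d. \<bar>x i\<bar>)"
      by (simp add: algebra_simps)
    ultimately show ?case unfolding prod.lessThan_Suc sum.lessThan_Suc by linarith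
  qed simp
  ultimately show ?thesis by simp
qed

text \<open>These are the test functions of the inversion argument. With the chosen normalisation
  the Fourier integral is a product of normal densities centred at \<open>y\<close>, so that pairing
  reads off a smoothed value of \<open>f\<close> near \<open>y\<close>, while on the frequency side
  the function tends to the character \<open>iexp (dotp d \<omega> y)\<close> as
  \<open>\<epsilon>\<close> tends to 0.\<close>

definition modulated_gaussian :: "nat \<Rightarrow> real \<Rightarrow> (nat \<Rightarrow> real) \<Rightarrow> (nat \<Rightarrow> real) \<Rightarrow> complex" where
  "modulated_gaussian d \<epsilon> y \<omega> = (\<Prod>i<d. of_real (exp (- (\<epsilon> * \<omega> i)\<^sup>2 / 2)) * iexp (y i * \<omega> i))"

lemma schwartz_modulated_gaussian:
  assumes \<epsilon>: "\<epsilon> > 0"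
  shows "schwartz d (modulated_gaussian d \<epsilon> y)"
proof -
  define U where "U = (\<lambda>i. gauss_deriv (\<epsilon>\<^sup>2 / 2) (y i))"
  \<comment> \<open>For a product of one-variable functions, an iterated partial derivative depends
    only on how often each direction occurs in \<open>\<alpha>\<close>.\<close>
  define D where "D = (\<lambda>\<alpha> x. \<Prod>i<d. U i (count_list \<alpha> i) (x i))"
  have c: "\<epsilon>\<^sup>2 / 2 > 0" using \<epsilon> by simp
  have D0: "D [] = modulated_gaussian d \<epsilon> y"
    by (simp add: D_def U_def modulated_gaussian_def gauss_deriv_0 fun_eq_iff power_mult_distrib)
  have cont: "continuous_map (powertop_real {..<d}) euclidean (D \<alpha>)" for \<alpha>
    unfolding D_def
  proof (rule continuous_map_prod_normed_algebra)
    fix i assume i: "i \<in> {..<d}"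
    have "continuous_on UNIV (U i (count_list \<alpha> i))"
      unfolding U_def
      by (intro continuous_at_imp_continuous_on ballI has_vector_derivative_continuous[OF has_vector_derivative_gauss_deriv])
    then have "continuous_map euclideanreal euclidean (U i (count_list \<alpha> i))" by simp
    from continuous_map_compose[OF continuous_map_product_projection[OF i] this]
    show "continuous_map (powertop_real {..<d}) euclidean (\<lambda>x. U i (count_list \<alpha> i) (x i))"
      by (simp add: comp_def)
  qed
  have deriv: "((\<lambda>t. D \<alpha> (x(i := t))) has_vector_derivative D (i # \<alpha>) x) (at (x i))" if i: "i < d" for \<alpha> x i
  proof -
    let ?R = "\<Prod>j\<in>{..<d} - {i}. U j (count_list \<alpha> j) (x j)"
    have 1: "D \<alpha> (x(i := t)) = U i (count_list \<alpha> i) t * ?R" for t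
      unfolding D_def using i by (subst prod.remove[of _ i]) (auto intro!: prod.cong arg_cong2[of _ _ _ _ "(*)"])
    have 2: "D (i # \<alpha>) x = U i (Suc (count_list \<alpha> i)) (x i) * ?R"
      unfolding D_def using i by (subst prod.remove[of _ i]) (auto intro!: prod.cong arg_cong2[of _ _ _ _ "(*)"])
    show ?thesis unfolding 1 2 U_def
      by (intro has_vector_derivative_mult_left has_vector_derivative_gauss_deriv)
  qed
  have bound: "\<exists>B. \<forall>x\<in>Rn d. (1 + enorm d x) ^ N * norm (D \<alpha> x) \<le> B" for \<alpha> N
  proof -
    have "\<forall>i. \<exists>B. \<forall>t. (1 + \<bar>t\<bar>) ^ N * norm (U i (count_list \<alpha> i) t) \<le> B"
      unfolding U_def using gauss_deriv_bounded[OF c] by blast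
    then obtain B where B: "\<And>i t. (1 + \<bar>t\<bar>) ^ N * norm (U i (count_list \<alpha> i) t) \<le> B i"
      by metis
    have "(1 + enorm d x) ^ N * norm (D \<alpha> x) \<le> (\<Prod>i<d. B i)" for x
    proof -
      have "(1 + enorm d x) ^ N \<le> (\<Prod>i<d. 1 + \<bar>x i\<bar>) ^ N"
        using one_plus_enorm_le_prod enorm_nonneg by (intro power_mono) (auto simp: add_nonneg_nonneg)
      then have "(1 + enorm d x) ^ N * norm (D \<alpha> x) \<le> (\<Prod>i<d. 1 + \<bar>x i\<bar>) ^ N * norm (D \<alpha> x)"
        by (rule mult_right_mono) simp
      also have "\<dots> = (\<Prod>i<d. (1 + \<bar>x i\<bar>) ^ N * norm (U i (count_list \<alpha> i) (x i)))"
        by (simp add: D_def prod_norm[symmetric] prod.distrib prod_power_distrib)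
      also have "\<dots> \<le> (\<Prod>i<d. B i)"
        using B by (intro prod_mono) auto
      finally show ?thesis .
    qed
    then show ?thesis by blast
  qed
  show ?thesis unfolding schwartz_def
    by (rule exI[of _ D]) (use D0 cont deriv bound in blast)
qed

abbreviation leb :: "nat \<Rightarrow> (nat \<Rightarrow> real) measure" where
  "leb d \<equiv> PiM {..<d} (\<lambda>_. lborel)"

lemma product_sigma_finite_lborel: "product_sigma_finite (\<lambda>_::nat. lborel :: real measure)"
  by standard

lemma integral_lebesgue_Rn:
  fixes f :: "(nat \<Rightarrow> real) \<Rightarrow> 'b::{banach, second_countable_topology}"
  assumes "f \<in> borel_measurable (PiM {..<d} (\<lambda>_. lborel))"
  shows "integral\<^sup>L (lebesgue_Rn d) f = integral\<^sup>L (PiM {..<d} (\<lambda>_. lborel)) f"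
  unfolding lebesgue_Rn_def by (rule integral_completion[OF assms])

lemma fourier_integral_modulated_gaussian:
  assumes \<epsilon>: "\<epsilon> > 0"
  shows "fourier_integral d (modulated_gaussian d \<epsilon> y) x = of_real (\<Prod>i<d. normal_density (y i) \<epsilon> (x i))"
proof -
  define u where "u = (\<lambda>i (t::real). complex_of_real (exp (- (\<epsilon> * t)\<^sup>2 / 2)) * iexp ((y i - x i) * t))"
  have eq: "modulated_gaussian d \<epsilon> y \<omega> * exp (- (\<i> * of_real (dotp d x \<omega>))) = (\<Prod>i<d. u i (\<omega> i))" for \<omega>
  proof -
    have "exp (- (\<i> * of_real (dotp d x \<omega>))) = (\<Prod>i<d. iexp (- (x i * \<omega> i)))"
      by (simp add: dotp_def exp_sum[symmetric] sum_negf sum_distrib_left)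
    moreover have "iexp (y i * \<omega> i) * iexp (- (x i * \<omega> i)) = iexp ((y i - x i) * \<omega> i)" for i
      by (simp add: exp_add[symmetric] algebra_simps)
    ultimately show ?thesis
      by (simp only: modulated_gaussian_def u_def prod.distrib[symmetric] mult.assoc)
  qed
  have "integrable lborel (\<lambda>t. exp (- (\<epsilon> * t)\<^sup>2 / 2))"
    unfolding gaussian_eq_normal_density[OF \<epsilon>] using \<epsilon> by simp
  then have ui: "integrable lborel (u i)" for i
    by (rule Bochner_Integration.integrable_bound) (auto simp: u_def norm_mult)
  have [measurable]: "u i \<in> borel_measurable borel" for i using ui[of i] by auto
  have "(\<integral>\<omega>. modulated_gaussian d \<epsilon> y \<omega> * exp (- (\<i> * of_real (dotp d x \<omega>))) \<partial>lebesgue_Rn d)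
      = (\<integral>\<omega>. (\<Prod>i<d. u i (\<omega> i)) \<partial>PiM {..<d} (\<lambda>_. lborel))"
    unfolding eq by (rule integral_lebesgue_Rn) measurable
  also have "\<dots> = (\<Prod>i<d. integral\<^sup>L lborel (u i))"
    by (rule product_sigma_finite.product_integral_prod[OF product_sigma_finite_lborel]) (use ui in auto)
  also have "\<dots> = (\<Prod>i<d. of_real (2 * pi * normal_density (y i) \<epsilon> (x i)))"
  proof (rule prod.cong[OF refl])
    fix i
    have "normal_density 0 \<epsilon> (y i - x i) = normal_density (y i) \<epsilon> (x i)"
      by (simp add: normal_density_def power2_commute)
    then show "integral\<^sup>L lborel (u i) = of_real (2 * pi * normal_density (y i) \<epsilon> (x i))"
      unfolding u_def fourier_gaussian[OF \<epsilon>] by simp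
  qed
  also have "\<dots> = (2 * pi) ^ d *\<^sub>R of_real (\<Prod>i<d. normal_density (y i) \<epsilon> (x i))"
    by (simp add: prod.distrib scaleR_conv_of_real)
  finally show ?thesis unfolding fourier_integral_def by simp
qed

section \<open>Cuboids as a generator of the product sigma-algebra\<close>

abbreviation cuboid :: "nat \<Rightarrow> (nat \<Rightarrow> real) \<Rightarrow> (nat \<Rightarrow> real) \<Rightarrow> (nat \<Rightarrow> real) set" where
  "cuboid d a b \<equiv> (\<Pi>\<^sub>E i\<in>{..<d}. {a i..b i})"

lemma sigma_finite_leb: "sigma_finite_measure (leb d)"
  by (rule product_sigma_finite.sigma_finite[OF product_sigma_finite_lborel]) simp

lemma space_leb: "space (leb d) = Rn d"
  by (simp add: space_PiM Rn_def)

lemma sets_cuboid[measurable]: "cuboid d a b \<in> sets (leb d)"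
  by (rule sets_PiM_I_finite) auto

lemma emeasure_cuboid_finite: "emeasure (leb d) (cuboid d a b) < \<infinity>"
  by (subst product_sigma_finite.emeasure_PiM[OF product_sigma_finite_lborel]) (auto simp: emeasure_lborel_Icc_eq prod_ennreal simp del: ennreal_0 cong: prod.cong)

text \<open>A half-space \<open>x i \<le> c\<close> is a countable union of growing cuboids, so the
  coordinate projections are already measurable for the sigma-algebra generated by cuboids.\<close>

lemma sets_leb_cuboids:
  "sets (leb d) = sigma_sets (Rn d) {cuboid d a b | a b. True}" (is "_ = sigma_sets _ ?E")
proof
  have EI: "cuboid d a b \<in> ?E" for a b by blast
  have E: "?E \<subseteq> Pow (Rn d)" by (auto simp: Rn_def PiE_iff)
  show "sigma_sets (Rn d) ?E \<subseteq> sets (leb d)"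
    unfolding space_leb[symmetric] by (rule sets.sigma_sets_subset) auto
  define N where "N = sigma (Rn d) ?E"
  have N: "space N = Rn d" "sets N = sigma_sets (Rn d) ?E"
    unfolding N_def using E by auto
  have proj: "(\<lambda>x. x i) \<in> borel_measurable N" if i: "i < d" for i
  proof (rule borel_measurableI_le)
    fix c :: real
    have "{x \<in> space N. x i \<le> c} = (\<Union>k::nat. cuboid d (\<lambda>_. - real k) (\<lambda>j. if j = i then c else real k))"
    proof safe
      fix x assume x: "x \<in> space N" "x i \<le> c"
      obtain k :: nat where k: "(\<Sum>j<d. \<bar>x j\<bar>) \<le> real k" using real_arch_simple by blast
      have "\<bar>x j\<bar> \<le> real k" if "j < d" for j
        using k member_le_sum[of j "{..<d}" "\<lambda>j. \<bar>x j\<bar>"] that by auto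
      then show "x \<in> (\<Union>k::nat. cuboid d (\<lambda>_. - real k) (\<lambda>j. if j = i then c else real k))"
        using x i by (intro UN_I[of k]) (auto simp: N(1) Rn_def PiE_iff abs_le_iff minus_le_iff)
    next
      fix x k assume "x \<in> cuboid d (\<lambda>_. - real k) (\<lambda>j. if j = i then c else real k)"
      then show "x \<in> space N" "x i \<le> c"
        using i PiE_mem[of x "{..<d}" "\<lambda>j. {- real k..if j = i then c else real k}" i]
        by (simp_all add: N(1) Rn_def PiE_iff)
    qed
    also have "\<dots> \<in> sets N"
    proof (rule sets.countable_UN, rule image_subsetI)
      fix k :: nat
      show "cuboid d (\<lambda>_. - real k) (\<lambda>j. if j = i then c else real k) \<in> sets N"
        unfolding N(2) by (rule sigma_sets.Basic) (rule EI)
    qed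
    finally show "{x \<in> space N. x i \<le> c} \<in> sets N" .
  qed
  have "sets (leb d) \<subseteq> sets N"
  proof (rule sets_PiM_in_sets)
    show "space N = (\<Pi>\<^sub>E i\<in>{..<d}. space lborel)" by (simp add: N(1) Rn_def)
    fix i :: nat and A :: "real set" assume "i \<in> {..<d}" "A \<in> sets lborel"
    then show "{x \<in> space N. x i \<in> A} \<in> sets N"
      using measurable_sets[OF proj, of i A] by (simp add: vimage_def Int_def conj_commute)
  qed
  then show "sets (leb d) \<subseteq> sigma_sets (Rn d) ?E" unfolding N(2) .
qed

text \<open>As \<open>v\<close> is only integrable on cuboids, its positive and negative parts are
  densities of possibly infinite measures. These are finite and equal on cuboids, an
  intersection-stable generator with an exhausting sequence, hence equal; a density is unique almost
  everywhere.\<close>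

lemma AE_zero_if_cuboid_integrals_zero:
  fixes v :: "(nat \<Rightarrow> real) \<Rightarrow> real"
  assumes v[measurable]: "v \<in> borel_measurable (leb d)"
    and int: "\<And>a b. integrable (leb d) (\<lambda>x. indicator (cuboid d a b) x * v x)"
    and zero: "\<And>a b. (\<integral>x. indicator (cuboid d a b) x * v x \<partial>leb d) = 0"
  shows "AE x in leb d. v x = 0"
proof -
  interpret sigma_finite_measure "leb d" by (rule sigma_finite_leb)
  let ?E = "{cuboid d a b | a b. True}"
  have EI: "cuboid d a b \<in> ?E" for a b by blast
  let ?M = "density (leb d) (\<lambda>x. ennreal (max (v x) 0))"
  let ?N = "density (leb d) (\<lambda>x. ennreal (max (- v x) 0))"
  have em: "emeasure (density (leb d) (\<lambda>x. ennreal (max (u x) 0))) (cuboid d a b)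
      = ennreal (\<integral>x. indicator (cuboid d a b) x * max (u x) 0 \<partial>leb d)"
    and iu: "integrable (leb d) (\<lambda>x. indicator (cuboid d a b) x * max (u x) 0)"
    if u: "integrable (leb d) (\<lambda>x. indicator (cuboid d a b) x * u x)" "u \<in> borel_measurable (leb d)" for u a b
  proof -
    have [measurable]: "u \<in> borel_measurable (leb d)" using u by auto
    show i: "integrable (leb d) (\<lambda>x. indicator (cuboid d a b) x * max (u x) 0)"
      by (rule Bochner_Integration.integrable_bound[OF u(1)]) (auto simp: indicator_def)
    have "emeasure (density (leb d) (\<lambda>x. ennreal (max (u x) 0))) (cuboid d a b)
      = (\<integral>\<^sup>+x. ennreal (indicator (cuboid d a b) x * max (u x) 0) \<partial>leb d)"
      by (subst emeasure_density) (auto intro!: nn_integral_cong simp: indicator_def)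
    also have "\<dots> = ennreal (\<integral>x. indicator (cuboid d a b) x * max (u x) 0 \<partial>leb d)"
      by (rule nn_integral_eq_integral[OF i]) auto
    finally show "emeasure (density (leb d) (\<lambda>x. ennreal (max (u x) 0))) (cuboid d a b)
      = ennreal (\<integral>x. indicator (cuboid d a b) x * max (u x) 0 \<partial>leb d)" .
  qed
  have int': "integrable (leb d) (\<lambda>x. indicator (cuboid d a b) x * - v x)" for a b
    using int[of a b] by simp
  have eq: "emeasure ?M (cuboid d a b) = emeasure ?N (cuboid d a b)" for a b
  proof -
    have "(\<integral>x. indicator (cuboid d a b) x * max (v x) 0 \<partial>leb d) - (\<integral>x. indicator (cuboid d a b) x * max (- v x) 0 \<partial>leb d)
       = (\<integral>x. indicator (cuboid d a b) x * max (v x) 0 - indicator (cuboid d a b) x * max (- v x) 0 \<partial>leb d)"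
      using iu[OF int v] iu[OF int'] by simp
    also have "\<dots> = (\<integral>x. indicator (cuboid d a b) x * v x \<partial>leb d)"
      by (rule Bochner_Integration.integral_cong) (auto simp: max_def)
    finally show ?thesis using em[OF int v] em[OF int'] zero by simp
  qed
  have "?M = ?N"
  proof (rule measure_eqI_generator_eq[where E="?E" and \<Omega>="Rn d" and A="\<lambda>k. cuboid d (\<lambda>_. - real k) (\<lambda>_. real k)"])
    show "Int_stable ?E"
    proof (rule Int_stableI)
      fix A B assume "A \<in> ?E" "B \<in> ?E"
      then obtain a b a' b' where "A = cuboid d a b" "B = cuboid d a' b'" by blast
      then have "A \<inter> B = cuboid d (\<lambda>i. max (a i) (a' i)) (\<lambda>i. min (b i) (b' i))"
        by (auto simp: set_eq_iff PiE_iff)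
      then show "A \<inter> B \<in> ?E" by (simp only: EI)
    qed
    show "?E \<subseteq> Pow (Rn d)" by (auto simp: Rn_def PiE_iff)
    show "emeasure ?M X = emeasure ?N X" if "X \<in> ?E" for X using that eq by auto
    show "(\<Union>k::nat. cuboid d (\<lambda>_. - real k) (\<lambda>_. real k)) = Rn d"
    proof safe
      fix x assume x: "x \<in> Rn d"
      obtain k :: nat where k: "(\<Sum>j<d. \<bar>x j\<bar>) \<le> real k" using real_arch_simple by blast
      have "\<bar>x j\<bar> \<le> real k" if "j < d" for j
        using k member_le_sum[of j "{..<d}" "\<lambda>j. \<bar>x j\<bar>"] that by auto
      then show "x \<in> (\<Union>k::nat. cuboid d (\<lambda>_. - real k) (\<lambda>_. real k))"
        using x by (intro UN_I[of k]) (auto simp: Rn_def PiE_iff abs_le_iff minus_le_iff)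
    qed (auto simp: Rn_def PiE_iff)
    show "emeasure ?M (cuboid d (\<lambda>_. - real k) (\<lambda>_. real k)) \<noteq> \<infinity>" for k :: nat
      using em[OF int v] by simp
    show "range (\<lambda>k::nat. cuboid d (\<lambda>_. - real k) (\<lambda>_. real k)) \<subseteq> ?E"
      by (rule image_subsetI) (rule EI)
  qed (simp_all add: sets_leb_cuboids)
  then have "AE x in leb d. ennreal (max (v x) 0) = ennreal (max (- v x) 0)"
    by (intro density_unique) auto
  then show ?thesis by eventually_elim (auto simp: max_def split: if_splits)
qed

text \<open>Discards the faces of cuboids, where smoothed indicators fail to converge to the
  indicator.\<close>

lemma AE_component_neq:
  assumes "i < d"
  shows "AE x in leb d. x i \<noteq> c"
proof (rule AE_I[where N="\<Pi>\<^sub>E j\<in>{..<d}. if j = i then {c} else UNIV"])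
  show "{x \<in> space (leb d). \<not> x i \<noteq> c} \<subseteq> (\<Pi>\<^sub>E j\<in>{..<d}. if j = i then {c} else UNIV)"
    by (auto simp: space_PiM PiE_iff extensional_def)
  have "emeasure (leb d) (\<Pi>\<^sub>E j\<in>{..<d}. if j = i then {c} else UNIV)
      = (\<Prod>j<d. emeasure lborel (if j = i then {c} else UNIV))"
    by (rule product_sigma_finite.emeasure_PiM[OF product_sigma_finite_lborel]) auto
  also have "\<dots> = 0" using assms by (intro prod_zero) auto
  finally show "emeasure (leb d) (\<Pi>\<^sub>E j\<in>{..<d}. if j = i then {c} else UNIV) = 0" .
qed (rule sets_PiM_I_finite, auto)

section \<open>Gaussian smoothing of cuboid indicators\<close>

text \<open>The convolution of an interval's indicator with a normal density, written with the
  centre \<open>y\<close> as integration variable. It arises in this form when centres of test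
  functions are integrated over a cuboid.\<close>

definition smooth_interval :: "real \<Rightarrow> real \<Rightarrow> real \<Rightarrow> real \<Rightarrow> real" where
  "smooth_interval a b \<epsilon> t = (\<integral>y. indicator {a..b} y * normal_density y \<epsilon> t \<partial>lborel)"

text \<open>The substitution \<open>y = t + \<epsilon> * z\<close> moves all dependence on
  \<open>\<epsilon>\<close> into the indicator, which suits both the uniform bound and dominated
  convergence.\<close>

lemma smooth_interval_eq:
  assumes "\<epsilon> > 0"
  shows "smooth_interval a b \<epsilon> t = (\<integral>z. indicator {a..b} (t + \<epsilon> * z) * std_normal_density z \<partial>lborel)"
proof -
  have "smooth_interval a b \<epsilon> t = \<epsilon> * (\<integral>z. indicator {a..b} (t + \<epsilon> * z) * normal_density (t + \<epsilon> * z) \<epsilon> t \<partial>lborel)"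
    unfolding smooth_interval_def
    using assms lborel_integral_real_affine[of \<epsilon> "\<lambda>y. indicator {a..b} y * normal_density y \<epsilon> t" t] by simp
  also have "\<dots> = (\<integral>z. \<epsilon> * (indicator {a..b} (t + \<epsilon> * z) * normal_density (t + \<epsilon> * z) \<epsilon> t) \<partial>lborel)"
    by simp
  also have "\<dots> = (\<integral>z. indicator {a..b} (t + \<epsilon> * z) * std_normal_density z \<partial>lborel)"
    using assms
    by (intro Bochner_Integration.integral_cong)
       (auto simp: normal_density_def real_sqrt_mult power_mult_distrib)
  finally show ?thesis .
qed

lemma smooth_interval_nonneg: "0 \<le> smooth_interval a b \<epsilon> t"
  unfolding smooth_interval_def by (rule Bochner_Integration.integral_nonneg) auto

lemma integrable_smooth_interval_integrand:
  assumes "\<epsilon> > 0"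
  shows "integrable lborel (\<lambda>y. indicator {a..b} y * normal_density y \<epsilon> t)"
proof -
  have "normal_density y \<epsilon> t = normal_density t \<epsilon> y" for y
    by (simp add: normal_density_def power2_commute)
  then show ?thesis
    by (intro Bochner_Integration.integrable_bound[OF integrable_normal_density[OF assms, of t]])
       (auto simp: indicator_def)
qed

text \<open>Where the indicator is nonzero, \<open>|t| \<le> |a| + |b| + |z|\<close> because
  \<open>\<epsilon> \<le> 1\<close>, so a power of \<open>1 + |t|\<close> is paid for by Gaussian
  moments in \<open>z\<close>. Uniformity in \<open>\<epsilon>\<close> provides a single dominating
  function for the limit.\<close>

lemma smooth_interval_decay:
  "\<exists>K. \<forall>\<epsilon> t. 0 < \<epsilon> \<longrightarrow> \<epsilon> \<le> 1 \<longrightarrow> (1 + \<bar>t\<bar>) ^ N * smooth_interval a b \<epsilon> t \<le> K"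
proof -
  define R where "R = \<bar>a\<bar> + \<bar>b\<bar>"
  have iK: "integrable lborel (\<lambda>z. (1 + R + \<bar>z\<bar>) ^ N * std_normal_density z)"
  proof -
    have "(1 + R + \<bar>z\<bar>) ^ N * std_normal_density z
       = (\<Sum>k\<le>N. real (N choose k) * (1 + R) ^ k * (std_normal_density z * \<bar>z\<bar> ^ (N - k)))" for z
      by (subst binomial_ring) (simp add: sum_distrib_left mult_ac)
    then show ?thesis
      using integrable_std_normal_moment_abs by simp
  qed
  have "(1 + \<bar>t\<bar>) ^ N * smooth_interval a b \<epsilon> t \<le> (\<integral>z. (1 + R + \<bar>z\<bar>) ^ N * std_normal_density z \<partial>lborel)"
    if \<epsilon>: "0 < \<epsilon>" "\<epsilon> \<le> 1" for \<epsilon> t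
  proof -
    have "(1 + \<bar>t\<bar>) ^ N * smooth_interval a b \<epsilon> t
       = (\<integral>z. (1 + \<bar>t\<bar>) ^ N * (indicator {a..b} (t + \<epsilon> * z) * std_normal_density z) \<partial>lborel)"
      using \<epsilon> by (simp add: smooth_interval_eq)
    also have "\<dots> \<le> (\<integral>z. (1 + R + \<bar>z\<bar>) ^ N * std_normal_density z \<partial>lborel)"
    proof (rule integral_mono)
      show "integrable lborel (\<lambda>z. (1 + \<bar>t\<bar>) ^ N * (indicator {a..b} (t + \<epsilon> * z) * std_normal_density z))"
        by (intro integrable_mult_right Bochner_Integration.integrable_bound[OF integrable_normal_density[of 1 0]]) (auto simp: indicator_def)
      show "integrable lborel (\<lambda>z. (1 + R + \<bar>z\<bar>) ^ N * std_normal_density z)" by fact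
      fix z :: real
      show "(1 + \<bar>t\<bar>) ^ N * (indicator {a..b} (t + \<epsilon> * z) * std_normal_density z) \<le> (1 + R + \<bar>z\<bar>) ^ N * std_normal_density z"
      proof (cases "t + \<epsilon> * z \<in> {a..b}")
        case True
        have "\<bar>\<epsilon> * z\<bar> \<le> \<bar>z\<bar>" using \<epsilon> by (simp add: abs_mult mult_left_le_one_le)
        then have "\<bar>t\<bar> \<le> R + \<bar>z\<bar>" using True by (auto simp: R_def)
        then have "(1 + \<bar>t\<bar>) ^ N \<le> (1 + R + \<bar>z\<bar>) ^ N" by (intro power_mono) auto
        then show ?thesis using True by (auto intro!: mult_right_mono)
      next
        case False
        then show ?thesis by (simp add: R_def)
      qed
    qed
    finally show ?thesis .
  qed
  then show ?thesis by blast
qed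

lemma smooth_interval_tendsto:
  assumes t: "t \<noteq> a" "t \<noteq> b" and \<epsilon>: "\<And>n. \<epsilon> n > 0" "\<epsilon> \<longlonglongrightarrow> 0"
  shows "(\<lambda>n. smooth_interval a b (\<epsilon> n) t) \<longlonglongrightarrow> indicator {a..b} t"
proof -
  have "(\<lambda>n. \<integral>z. indicator {a..b} (t + \<epsilon> n * z) * std_normal_density z \<partial>lborel)
      \<longlonglongrightarrow> (\<integral>z. indicator {a..b} t * std_normal_density z \<partial>lborel)"
  proof (rule integral_dominated_convergence[where w=std_normal_density])
    show "AE z in lborel. (\<lambda>n. indicator {a..b} (t + \<epsilon> n * z) * std_normal_density z)
        \<longlonglongrightarrow> indicator {a..b} t * std_normal_density z"
    proof (rule AE_I2)
      fix z :: real
      have "t \<notin> frontier {a..b}" using t by (auto simp: frontier_def)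
      then have "isCont (indicator {a..b} :: real \<Rightarrow> real) t" by (simp add: isCont_indicator)
      moreover have "(\<lambda>n. t + \<epsilon> n * z) \<longlonglongrightarrow> t + 0 * z"
        by (intro tendsto_intros \<epsilon>)
      ultimately have "(\<lambda>n. indicator {a..b} (t + \<epsilon> n * z) :: real) \<longlonglongrightarrow> indicator {a..b} t"
        by (intro isCont_tendsto_compose[of t "indicator {a..b}"]) auto
      then show "(\<lambda>n. indicator {a..b} (t + \<epsilon> n * z) * std_normal_density z)
        \<longlonglongrightarrow> indicator {a..b} t * std_normal_density z" by (intro tendsto_intros)
    qed
  qed (auto simp: indicator_def)
  then show ?thesis using \<epsilon>(1) by (simp add: smooth_interval_eq)
qed

section \<open>Inversion almost everywhere by testing against Gaussians\<close>

lemma measurable_dotp[measurable]: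
  "dotp d y \<in> borel_measurable (leb d)"
  "(\<lambda>x. dotp d x y) \<in> borel_measurable (leb d)"
  "(\<lambda>z. dotp d (fst z) (snd z)) \<in> borel_measurable (leb d \<Otimes>\<^sub>M leb d)"
  "(\<lambda>z. dotp d (snd z) (fst z)) \<in> borel_measurable (leb d \<Otimes>\<^sub>M leb d)"
  "(\<lambda>z. dotp d (fst z) y) \<in> borel_measurable (leb d \<Otimes>\<^sub>M lborel)"
  "(\<lambda>z. dotp d (fst (fst z)) (snd z)) \<in> borel_measurable ((leb d \<Otimes>\<^sub>M lborel) \<Otimes>\<^sub>M leb d)"
  "(\<lambda>z. dotp d (fst (fst z)) y) \<in> borel_measurable ((leb d \<Otimes>\<^sub>M lborel) \<Otimes>\<^sub>M leb d)"
  "(\<lambda>z. dotp d (fst (snd z)) (fst z)) \<in> borel_measurable (leb d \<Otimes>\<^sub>M (leb d \<Otimes>\<^sub>M lborel))"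
  "(\<lambda>z. dotp d (fst (snd z)) y) \<in> borel_measurable (leb d \<Otimes>\<^sub>M (leb d \<Otimes>\<^sub>M lborel))"
  unfolding dotp_def[abs_def] by measurable

lemma measurable_enorm[measurable]: "enorm d \<in> borel_measurable (leb d)"
  unfolding enorm_def[abs_def] L2_set_def by measurable

lemma measurable_modulated_gaussian[measurable]:
  "modulated_gaussian d \<epsilon> y \<in> borel_measurable (leb d)"
  "(\<lambda>z. modulated_gaussian d \<epsilon> (fst z) (snd z)) \<in> borel_measurable (leb d \<Otimes>\<^sub>M leb d)"
  unfolding modulated_gaussian_def[abs_def] by measurable

lemma norm_modulated_gaussian_le: "norm (modulated_gaussian d \<epsilon> y \<omega>) \<le> 1"
  unfolding modulated_gaussian_def prod_norm[symmetric]
  by (intro prod_le_1) (auto simp: norm_mult)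

lemma modulated_gaussian_tendsto:
  assumes "e \<longlonglongrightarrow> 0"
  shows "(\<lambda>n. modulated_gaussian d (e n) y \<omega>) \<longlonglongrightarrow> iexp (dotp d \<omega> y)"
proof -
  have "(\<lambda>n. modulated_gaussian d (e n) y \<omega>)
      \<longlonglongrightarrow> (\<Prod>i<d. of_real (exp (- (0 * \<omega> i)\<^sup>2 / 2)) * iexp (y i * \<omega> i))"
    unfolding modulated_gaussian_def by (intro tendsto_intros assms) auto
  also have "(\<Prod>i<d. of_real (exp (- (0 * \<omega> i)\<^sup>2 / 2)) * iexp (y i * \<omega> i)) = iexp (dotp d \<omega> y)"
    by (simp add: dotp_def exp_sum[symmetric] sum_distrib_left mult_ac)
  finally show ?thesis .
qed

lemma indicator_cuboid_eq_prod:
  assumes "y \<in> space (leb d)"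
  shows "indicator (cuboid d a b) y = (\<Prod>i<d. indicator {a i..b i} (y i) :: real)"
proof (cases "y \<in> cuboid d a b")
  case True
  then show ?thesis by (auto simp: PiE_iff intro!: prod.neutral[symmetric])
next
  case False
  then obtain i where "i < d" "y i \<notin> {a i..b i}"
    using assms by (auto simp: space_PiM PiE_iff)
  then have "(\<Prod>i<d. indicator {a i..b i} (y i) :: real) = 0"
    by (intro prod_zero) (auto intro!: bexI[of _ i])
  then show ?thesis using False by simp
qed

lemma AE_lebesgue_Rn: "(AE x in lebesgue_Rn d. Q x) \<longleftrightarrow> (AE x in leb d. Q x)"
  unfolding lebesgue_Rn_def by (rule AE_completion_iff)

lemma tempered_function_measurable:
  assumes u: "tempered_function d u"
  shows "u \<in> borel_measurable (lebesgue_Rn d)"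
proof -
  obtain N where "integrable (lebesgue_Rn d) (\<lambda>x. u x / of_real ((1 + enorm d x) ^ N))"
    using u unfolding tempered_function_def by blast
  then have *: "(\<lambda>x. u x / of_real ((1 + enorm d x) ^ N)) \<in> borel_measurable (lebesgue_Rn d)" by auto
  have **: "(\<lambda>x. complex_of_real ((1 + enorm d x) ^ N)) \<in> borel_measurable (lebesgue_Rn d)"
    unfolding lebesgue_Rn_def by (rule measurable_completion) measurable
  have "u x / of_real ((1 + enorm d x) ^ N) * of_real ((1 + enorm d x) ^ N) = u x" for x
  proof (rule nonzero_eq_divide_eq[THEN iffD1])
    have "(1 + enorm d x) ^ N \<noteq> 0" using enorm_nonneg[of d x] by (auto simp: power_eq_0_iff)
    then show "complex_of_real ((1 + enorm d x) ^ N) \<noteq> 0" by (simp only: of_real_eq_0_iff not_False_eq_True)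
  qed simp
  then show ?thesis using borel_measurable_times[OF * **] by simp
qed

text \<open>Pairings with Schwartz functions determine \<open>f\<close> only up to null sets, whence
  the form of the conclusion. \<open>h\<close> and \<open>G\<close> stand for Borel representatives
  of \<open>f\<close> and its transform, so that Fubini can run on the product measure itself rather
  than on its completion.\<close>

lemma fourier_inversion_AE:
  fixes f h :: "(nat \<Rightarrow> real) \<Rightarrow> real"
  assumes ft: "has_fourier_transform d (\<lambda>x. complex_of_real (f x)) g"
    and h[measurable]: "h \<in> borel_measurable (leb d)" and fh: "AE x in leb d. f x = h x"
    and G: "integrable (leb d) G" and gG: "AE \<omega> in leb d. g \<omega> = G \<omega>"
  shows "AE x in leb d. h x = Re (\<integral>\<omega>. G \<omega> * iexp (dotp d \<omega> x) \<partial>leb d)"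
proof -
  interpret P: pair_sigma_finite "leb d" "leb d"
    using sigma_finite_leb by (simp add: pair_sigma_finite_def)
  have [measurable]: "G \<in> borel_measurable (leb d)" using G by auto
  have one_le: "1 \<le> 1 + enorm d x" for x using enorm_nonneg[of d x] by simp
  have temp_f: "tempered_function d (\<lambda>x. complex_of_real (f x))" and temp_g: "tempered_function d g"
    using ft by (auto simp: has_fourier_transform_def)
  obtain N where N: "integrable (lebesgue_Rn d) (\<lambda>x. complex_of_real (f x) / of_real ((1 + enorm d x) ^ N))"
    using temp_f unfolding tempered_function_def by blast
  have hN: "integrable (leb d) (\<lambda>x. h x / (1 + enorm d x) ^ N)"
  proof -
    have "integrable (lebesgue_Rn d) (\<lambda>x. complex_of_real (h x / (1 + enorm d x) ^ N))"
    proof (rule integrable_cong_AE_imp[OF N])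
      show "(\<lambda>x. complex_of_real (h x / (1 + enorm d x) ^ N)) \<in> borel_measurable (lebesgue_Rn d)"
        unfolding lebesgue_Rn_def by (rule measurable_completion) measurable
      show "AE x in lebesgue_Rn d. complex_of_real (f x) / of_real ((1 + enorm d x) ^ N)
          = complex_of_real (h x / (1 + enorm d x) ^ N)"
        unfolding AE_lebesgue_Rn using fh by eventually_elim simp
    qed
    then have "integrable (leb d) (\<lambda>x. complex_of_real (h x / (1 + enorm d x) ^ N))"
      unfolding lebesgue_Rn_def by (subst (asm) integrable_completion) auto
    then show ?thesis by (simp only: complex_of_real_integrable_eq)
  qed
  have test: "(\<integral>\<omega>. G \<omega> * modulated_gaussian d \<epsilon> y \<omega> \<partial>leb d)
      = complex_of_real (\<integral>x. h x * (\<Prod>i<d. normal_density (y i) \<epsilon> (x i)) \<partial>leb d)"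
    if \<epsilon>: "\<epsilon> > 0" for \<epsilon> y
  proof -
    have "(\<integral>\<omega>. G \<omega> * modulated_gaussian d \<epsilon> y \<omega> \<partial>leb d)
       = (\<integral>\<omega>. G \<omega> * modulated_gaussian d \<epsilon> y \<omega> \<partial>lebesgue_Rn d)"
      by (rule integral_lebesgue_Rn[symmetric]) measurable
    also have "\<dots> = (\<integral>\<omega>. g \<omega> * modulated_gaussian d \<epsilon> y \<omega> \<partial>lebesgue_Rn d)"
    proof (rule integral_cong_AE)
      have m: "modulated_gaussian d \<epsilon> y \<in> borel_measurable (lebesgue_Rn d)" "G \<in> borel_measurable (lebesgue_Rn d)"
        unfolding lebesgue_Rn_def by (intro measurable_completion; measurable)+
      show "(\<lambda>\<omega>. G \<omega> * modulated_gaussian d \<epsilon> y \<omega>) \<in> borel_measurable (lebesgue_Rn d)"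
        using m by (intro borel_measurable_times)
      show "(\<lambda>\<omega>. g \<omega> * modulated_gaussian d \<epsilon> y \<omega>) \<in> borel_measurable (lebesgue_Rn d)"
        using m tempered_function_measurable[OF temp_g] by (intro borel_measurable_times)
      show "AE \<omega> in lebesgue_Rn d. G \<omega> * modulated_gaussian d \<epsilon> y \<omega> = g \<omega> * modulated_gaussian d \<epsilon> y \<omega>"
        unfolding AE_lebesgue_Rn using gG by eventually_elim simp
    qed
    also have "\<dots> = (\<integral>x. complex_of_real (f x) * fourier_integral d (modulated_gaussian d \<epsilon> y) x \<partial>lebesgue_Rn d)"
      using ft schwartz_modulated_gaussian[OF \<epsilon>] by (auto simp: has_fourier_transform_def)
    also have "\<dots> = (\<integral>x. complex_of_real (h x * (\<Prod>i<d. normal_density (y i) \<epsilon> (x i))) \<partial>lebesgue_Rn d)"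
    proof (rule integral_cong_AE)
      have m: "(\<lambda>x. complex_of_real (\<Prod>i<d. normal_density (y i) \<epsilon> (x i))) \<in> borel_measurable (lebesgue_Rn d)"
        unfolding lebesgue_Rn_def by (rule measurable_completion) measurable
      then show "(\<lambda>x. complex_of_real (f x) * fourier_integral d (modulated_gaussian d \<epsilon> y) x) \<in> borel_measurable (lebesgue_Rn d)"
        unfolding fourier_integral_modulated_gaussian[OF \<epsilon>] using tempered_function_measurable[OF temp_f] by (intro borel_measurable_times)
      show "(\<lambda>x. complex_of_real (h x * (\<Prod>i<d. normal_density (y i) \<epsilon> (x i)))) \<in> borel_measurable (lebesgue_Rn d)"
        unfolding lebesgue_Rn_def by (rule measurable_completion) measurable
      show "AE x in lebesgue_Rn d. complex_of_real (f x) * fourier_integral d (modulated_gaussian d \<epsilon> y) x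
          = complex_of_real (h x * (\<Prod>i<d. normal_density (y i) \<epsilon> (x i)))"
        unfolding AE_lebesgue_Rn fourier_integral_modulated_gaussian[OF \<epsilon>] using fh by eventually_elim simp
    qed
    also have "\<dots> = (\<integral>x. complex_of_real (h x * (\<Prod>i<d. normal_density (y i) \<epsilon> (x i))) \<partial>leb d)"
      by (rule integral_lebesgue_Rn) measurable
    finally show ?thesis by (simp only: integral_complex_of_real)
  qed
  define F where "F = (\<lambda>x. \<integral>\<omega>. G \<omega> * iexp (dotp d \<omega> x) \<partial>leb d)"
  have Fm[measurable]: "F \<in> borel_measurable (leb d)"
    unfolding F_def by (rule sigma_finite_measure.borel_measurable_lebesgue_integral[OF sigma_finite_leb]) (simp add: split_beta')
  have Fb: "norm (F x) \<le> (\<integral>\<omega>. norm (G \<omega>) \<partial>leb d)" for x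
    unfolding F_def using integral_norm_bound[of "leb d" "\<lambda>\<omega>. G \<omega> * iexp (dotp d \<omega> x)"] by (simp add: norm_mult)
  define e where "e = (\<lambda>n. 1 / real (Suc n))"
  have e: "e n > 0" "e n \<le> 1" "e \<longlonglongrightarrow> 0" for n
    unfolding e_def using LIMSEQ_Suc[OF lim_inverse_n'] by auto
  \<comment> \<open>Testing the transform against modulated Gaussians yields the convolution of \<open>h\<close> with normal
    densities; its integral over a cuboid converges to that of \<open>h\<close> as the deviation tends to 0.\<close>
  have box: "integrable (leb d) (\<lambda>x. indicator (cuboid d a b) x * (h x - Re (F x))) \<and>
      (\<integral>x. indicator (cuboid d a b) x * (h x - Re (F x)) \<partial>leb d) = 0" for a b
  proof -
    let ?B = "cuboid d a b"
    define W where "W = (\<lambda>\<epsilon> x. \<Prod>i<d. smooth_interval (a i) (b i) \<epsilon> (x i))"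
    have "\<forall>i. \<exists>K. \<forall>\<epsilon> t. 0 < \<epsilon> \<longrightarrow> \<epsilon> \<le> 1 \<longrightarrow> (1 + \<bar>t\<bar>) ^ N * smooth_interval (a i) (b i) \<epsilon> t \<le> K"
      using smooth_interval_decay by blast
    then obtain K where K: "\<And>i \<epsilon> t. 0 < \<epsilon> \<Longrightarrow> \<epsilon> \<le> 1 \<Longrightarrow> (1 + \<bar>t\<bar>) ^ N * smooth_interval (a i) (b i) \<epsilon> t \<le> K i"
      by metis
    have W0: "0 \<le> W \<epsilon> x" for \<epsilon> x unfolding W_def by (intro prod_nonneg) (auto simp: smooth_interval_nonneg)
    have Wm[measurable]: "W (e n) \<in> borel_measurable (leb d)" for n
      unfolding W_def smooth_interval_eq[OF e(1)] by measurable
    \<comment> \<open>Only \<open>h x / (1 + enorm d x) ^ N\<close> is known to be integrable, so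
      the smoothed indicator has to absorb the polynomial weight. The bound is uniform in
      \<open>\<epsilon>\<close> and serves twice: for Fubini and for the limit of the integrals of
      \<open>h\<close>.\<close>
    have Wb: "\<bar>h x * W \<epsilon> x\<bar> \<le> (\<Prod>i<d. K i) * \<bar>h x / (1 + enorm d x) ^ N\<bar>" if \<epsilon>: "0 < \<epsilon>" "\<epsilon> \<le> 1" for \<epsilon> x
    proof -
      have "(1 + enorm d x) ^ N * W \<epsilon> x \<le> (\<Prod>i<d. 1 + \<bar>x i\<bar>) ^ N * W \<epsilon> x"
        using one_plus_enorm_le_prod one_le[of x] W0 by (intro mult_right_mono power_mono) auto
      also have "\<dots> = (\<Prod>i<d. (1 + \<bar>x i\<bar>) ^ N * smooth_interval (a i) (b i) \<epsilon> (x i))"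
        by (simp add: W_def prod.distrib prod_power_distrib)
      also have "\<dots> \<le> (\<Prod>i<d. K i)"
        using K[OF \<epsilon>] by (intro prod_mono) (auto simp: smooth_interval_nonneg)
      finally have *: "(1 + enorm d x) ^ N * W \<epsilon> x \<le> (\<Prod>i<d. K i)" .
      have pos: "(1 + enorm d x) ^ N > 0" using one_le[of x] by (intro zero_less_power) linarith
      have "\<bar>h x * W \<epsilon> x\<bar> = \<bar>h x / (1 + enorm d x) ^ N\<bar> * ((1 + enorm d x) ^ N * W \<epsilon> x)"
      proof -
        have "h x * W \<epsilon> x = h x / (1 + enorm d x) ^ N * ((1 + enorm d x) ^ N * W \<epsilon> x)"
          using pos by (metis less_irrefl mult.assoc nonzero_divide_eq_eq)
        then show ?thesis using pos W0[of \<epsilon> x] by (simp only: abs_mult)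
      qed
      also have "\<dots> \<le> \<bar>h x / (1 + enorm d x) ^ N\<bar> * (\<Prod>i<d. K i)"
        using * by (rule mult_left_mono) simp
      finally show ?thesis by (simp add: mult.commute)
    qed
    have dom: "integrable (leb d) (\<lambda>x. (\<Prod>i<d. K i) * \<bar>h x / (1 + enorm d x) ^ N\<bar>)"
      by (intro integrable_mult_right integrable_abs hN)
    have fub: "(\<integral>y. indicator ?B y * (\<integral>x. h x * (\<Prod>i<d. normal_density (y i) (e n) (x i)) \<partial>leb d) \<partial>leb d)
        = (\<integral>x. h x * W (e n) x \<partial>leb d)" for n
    proof -
      let ?k = "\<lambda>x y. h x * (\<Prod>i<d. indicator {a i..b i} (y i) * normal_density (y i) (e n) (x i))"
      have inti: "integrable lborel (\<lambda>y. indicator {a..b} y * normal_density y (e n) t)" for a b t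
        by (rule integrable_smooth_interval_integrand[OF e(1)])
      have ky: "integrable (leb d) (?k x)" and kW: "(\<integral>y. ?k x y \<partial>leb d) = h x * W (e n) x"
        and kW': "(\<integral>y. norm (?k x y) \<partial>leb d) = \<bar>h x * W (e n) x\<bar>" for x
      proof -
        have "integrable (leb d) (\<lambda>y. \<Prod>i<d. indicator {a i..b i} (y i) * normal_density (y i) (e n) (x i))"
          by (rule product_sigma_finite.product_integrable_prod[OF product_sigma_finite_lborel]) (use inti in auto)
        then show "integrable (leb d) (?k x)" by simp
        have I: "(\<integral>y. (\<Prod>i<d. indicator {a i..b i} (y i) * normal_density (y i) (e n) (x i)) \<partial>leb d) = W (e n) x"
          unfolding W_def smooth_interval_def by (rule product_sigma_finite.product_integral_prod[OF product_sigma_finite_lborel]) (use inti in auto)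
        then show "(\<integral>y. ?k x y \<partial>leb d) = h x * W (e n) x" by simp
        have "(\<integral>y. norm (?k x y) \<partial>leb d)
            = (\<integral>y. \<bar>h x\<bar> * (\<Prod>i<d. indicator {a i..b i} (y i) * normal_density (y i) (e n) (x i)) \<partial>leb d)"
          by (intro Bochner_Integration.integral_cong) (auto simp: abs_mult abs_prod)
        then show "(\<integral>y. norm (?k x y) \<partial>leb d) = \<bar>h x * W (e n) x\<bar>"
          using I W0[of "e n" x] by (simp add: abs_mult)
      qed
      have km: "(\<lambda>(x, y). ?k x y) \<in> borel_measurable (leb d \<Otimes>\<^sub>M leb d)"
        unfolding normal_density_def split_beta' by measurable
      have kint: "integrable (leb d \<Otimes>\<^sub>M leb d) (\<lambda>(x, y). ?k x y)"
      proof (rule P.Fubini_integrable[OF km])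
        show "integrable (leb d) (\<lambda>x. \<integral>y. norm (case (x, y) of (x, y) \<Rightarrow> ?k x y) \<partial>leb d)"
          unfolding split kW'
        proof (rule Bochner_Integration.integrable_bound[OF dom])
          show "(\<lambda>x. \<bar>h x * W (e n) x\<bar>) \<in> borel_measurable (leb d)" by measurable
          show "AE x in leb d. norm \<bar>h x * W (e n) x\<bar> \<le> norm ((\<Prod>i<d. K i) * \<bar>h x / (1 + enorm d x) ^ N\<bar>)"
            unfolding real_norm_def abs_idempotent
            by (intro AE_I2 order.trans[OF Wb[OF e(1,2)] abs_ge_self])
        qed
        show "AE x in leb d. integrable (leb d) (\<lambda>y. case (x, y) of (x, y) \<Rightarrow> ?k x y)"
          using ky by simp
      qed
      have "(\<integral>y. indicator ?B y * (\<integral>x. h x * (\<Prod>i<d. normal_density (y i) (e n) (x i)) \<partial>leb d) \<partial>leb d)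
          = (\<integral>y. (\<integral>x. ?k x y \<partial>leb d) \<partial>leb d)"
      proof (rule Bochner_Integration.integral_cong[OF refl])
        fix y assume y: "y \<in> space (leb d)"
        have "indicator ?B y * (\<integral>x. h x * (\<Prod>i<d. normal_density (y i) (e n) (x i)) \<partial>leb d)
            = (\<integral>x. indicator ?B y * (h x * (\<Prod>i<d. normal_density (y i) (e n) (x i))) \<partial>leb d)"
          by simp
        then show "indicator ?B y * (\<integral>x. h x * (\<Prod>i<d. normal_density (y i) (e n) (x i)) \<partial>leb d) = (\<integral>x. ?k x y \<partial>leb d)"
          unfolding indicator_cuboid_eq_prod[OF y] by (simp add: prod.distrib mult_ac)
      qed
      also have "\<dots> = (\<integral>x. (\<integral>y. ?k x y \<partial>leb d) \<partial>leb d)"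
        by (rule P.Fubini_integral[OF kint])
      finally show ?thesis unfolding kW .
    qed
    have hB: "integrable (leb d) (\<lambda>x. h x * indicator ?B x)"
      and limh: "(\<lambda>n. \<integral>x. h x * W (e n) x \<partial>leb d) \<longlonglongrightarrow> (\<integral>x. h x * indicator ?B x \<partial>leb d)"
    proof -
      have "AE x in leb d. \<forall>i<d. x i \<noteq> a i \<and> x i \<noteq> b i"
        using AE_component_neq by (subst AE_all_countable) (auto simp: AE_conj_iff)
      then have lim: "AE x in leb d. (\<lambda>n. h x * W (e n) x) \<longlonglongrightarrow> h x * indicator ?B x"
        using AE_space
      proof eventually_elim
        case (elim x)
        have "(\<lambda>n. W (e n) x) \<longlonglongrightarrow> (\<Prod>i<d. indicator {a i..b i} (x i))"
          unfolding W_def using elim by (intro tendsto_prod smooth_interval_tendsto e) auto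
        then show ?case unfolding indicator_cuboid_eq_prod[OF elim(2)] by (intro tendsto_intros)
      qed
      have bd: "AE x in leb d. norm (h x * W (e n) x) \<le> (\<Prod>i<d. K i) * \<bar>h x / (1 + enorm d x) ^ N\<bar>" for n
        using Wb[OF e(1,2)] by simp
      show "integrable (leb d) (\<lambda>x. h x * indicator ?B x)"
        by (rule integrable_dominated_convergence[OF _ _ dom lim bd]) auto
      show "(\<lambda>n. \<integral>x. h x * W (e n) x \<partial>leb d) \<longlonglongrightarrow> (\<integral>x. h x * indicator ?B x \<partial>leb d)"
        by (rule integral_dominated_convergence[OF _ _ dom lim bd]) auto
    qed
    have limG: "(\<lambda>n. \<integral>\<omega>. G \<omega> * modulated_gaussian d (e n) y \<omega> \<partial>leb d) \<longlonglongrightarrow> F y" if y: "y \<in> space (leb d)" for y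
      unfolding F_def
    proof (rule integral_dominated_convergence[where w="\<lambda>\<omega>. norm (G \<omega>)"])
      show "(\<lambda>\<omega>. G \<omega> * iexp (dotp d \<omega> y)) \<in> borel_measurable (leb d)" using y by measurable
      show "AE \<omega> in leb d. (\<lambda>n. G \<omega> * modulated_gaussian d (e n) y \<omega>) \<longlonglongrightarrow> G \<omega> * iexp (dotp d \<omega> y)"
        by (intro AE_I2 tendsto_intros modulated_gaussian_tendsto e)
      show "AE \<omega> in leb d. norm (G \<omega> * modulated_gaussian d (e n) y \<omega>) \<le> norm (G \<omega>)" for n
        using norm_modulated_gaussian_le by (auto simp: norm_mult intro!: mult_right_le_one_le)
    qed (use G in auto)
    have iB: "integrable (leb d) (\<lambda>y. indicator ?B y * (\<integral>\<omega>. norm (G \<omega>) \<partial>leb d))"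
      using emeasure_cuboid_finite[of d a b] by (intro integrable_mult_left) auto
    have limF: "(\<lambda>n. \<integral>y. indicator ?B y *\<^sub>R (\<integral>\<omega>. G \<omega> * modulated_gaussian d (e n) y \<omega> \<partial>leb d) \<partial>leb d)
        \<longlonglongrightarrow> (\<integral>y. indicator ?B y *\<^sub>R F y \<partial>leb d)"
    proof (rule integral_dominated_convergence[OF _ _ iB])
      show "AE y in leb d. (\<lambda>n. indicator ?B y *\<^sub>R (\<integral>\<omega>. G \<omega> * modulated_gaussian d (e n) y \<omega> \<partial>leb d))
          \<longlonglongrightarrow> indicator ?B y *\<^sub>R F y"
        by (intro AE_I2 tendsto_intros limG)
      fix n
      have "(\<lambda>y. \<integral>\<omega>. G \<omega> * modulated_gaussian d (e n) y \<omega> \<partial>leb d) \<in> borel_measurable (leb d)"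
        by (rule sigma_finite_measure.borel_measurable_lebesgue_integral[OF sigma_finite_leb]) (simp add: split_beta')
      then show "(\<lambda>y. indicator ?B y *\<^sub>R (\<integral>\<omega>. G \<omega> * modulated_gaussian d (e n) y \<omega> \<partial>leb d)) \<in> borel_measurable (leb d)"
        by measurable
      have "norm (\<integral>\<omega>. G \<omega> * modulated_gaussian d (e n) y \<omega> \<partial>leb d) \<le> (\<integral>\<omega>. norm (G \<omega>) \<partial>leb d)" for y
      proof (rule order.trans[OF integral_norm_bound], rule integral_mono)
        show "norm (G \<omega> * modulated_gaussian d (e n) y \<omega>) \<le> norm (G \<omega>)" for \<omega>
          using norm_modulated_gaussian_le by (auto simp: norm_mult intro!: mult_right_le_one_le)
        then show "integrable (leb d) (\<lambda>\<omega>. norm (G \<omega> * modulated_gaussian d (e n) y \<omega>))"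
          by (intro Bochner_Integration.integrable_bound[OF G]) auto
      qed (use G in auto)
      then show "AE y in leb d. norm (indicator ?B y *\<^sub>R (\<integral>\<omega>. G \<omega> * modulated_gaussian d (e n) y \<omega> \<partial>leb d))
          \<le> indicator ?B y * (\<integral>\<omega>. norm (G \<omega>) \<partial>leb d)"
        by (auto simp: indicator_def)
    qed measurable
    have "(\<integral>y. indicator ?B y *\<^sub>R (\<integral>\<omega>. G \<omega> * modulated_gaussian d (e n) y \<omega> \<partial>leb d) \<partial>leb d)
       = complex_of_real (\<integral>x. h x * W (e n) x \<partial>leb d)" for n
      unfolding test[OF e(1)] fub[symmetric] by (simp add: scaleR_conv_of_real flip: of_real_mult)
    \<comment> \<open>The same sequence has two limits: the frequency side tends to the cuboid
      integral of \<open>F\<close>, the space side to that of \<open>h\<close>.\<close>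
    then have "(\<integral>y. indicator ?B y *\<^sub>R F y \<partial>leb d) = complex_of_real (\<integral>x. h x * indicator ?B x \<partial>leb d)"
      using LIMSEQ_unique[OF limF] tendsto_of_real[OF limh, where 'a=complex] by simp
    moreover have iF: "integrable (leb d) (\<lambda>y. indicator ?B y *\<^sub>R F y)"
      by (rule Bochner_Integration.integrable_bound[OF iB]) (use Fb in \<open>auto simp: indicator_def intro: order.trans[OF _ abs_ge_self]\<close>)
    ultimately have "(\<integral>y. Re (indicator ?B y *\<^sub>R F y) \<partial>leb d) = (\<integral>x. h x * indicator ?B x \<partial>leb d)"
      by (simp only: integral_Re Re_complex_of_real)
    moreover have iRe: "integrable (leb d) (\<lambda>y. Re (indicator ?B y *\<^sub>R F y))"
      using iF by (rule integrable_Re)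
    ultimately show ?thesis
      using hB by (simp add: left_diff_distrib mult.commute)
  qed
  have "AE x in leb d. h x - Re (F x) = 0"
    by (rule AE_zero_if_cuboid_integrals_zero) (use box in auto)
  then show ?thesis unfolding F_def by simp
qed

section \<open>Approximation by shallow networks\<close>

text \<open>Extending by zero and restricting back transports the question to functions on all
  natural numbers. There the product topology is that of the type, and its Borel sets are those of
  the countable product sigma-algebra.\<close>

lemma openin_imp_sets_leb:
  assumes S: "openin (powertop_real {..<d}) S"
  shows "S \<in> sets (leb d)"
proof -
  define r where "r = (\<lambda>x::nat \<Rightarrow> real. restrict x {..<d})"
  define e where "e = (\<lambda>(x::nat \<Rightarrow> real) i. if i < d then x i else 0)"
  have "continuous_map (powertop_real UNIV) (powertop_real {..<d}) r"
    unfolding continuous_map_componentwise r_def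
    by (auto intro!: continuous_map_product_projection)
  then have "open (r -` S)"
    using openin_continuous_map_preimage[OF _ S] unfolding euclidean_product_topology
    by (fastforce simp: vimage_def)
  then have "r -` S \<in> sets (PiM UNIV (\<lambda>_. borel))"
    by (subst sets_PiM_equal_borel) auto
  moreover have "e \<in> measurable (leb d) (PiM UNIV (\<lambda>_. borel))"
  proof (rule measurable_PiM_single')
    show "(\<lambda>x. e x i) \<in> borel_measurable (leb d)" for i
      by (cases "i < d") (auto simp: e_def)
  qed auto
  ultimately have "e -` (r -` S) \<inter> space (leb d) \<in> sets (leb d)"
    by (rule measurable_sets[rotated])
  also have "e -` (r -` S) \<inter> space (leb d) = S"
  proof -
    have "r (e x) = x" if "x \<in> Rn d" for x
      using that by (auto simp: r_def e_def Rn_def PiE_iff extensional_def fun_eq_iff)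
    moreover have "S \<subseteq> Rn d" using openin_subset[OF S] by (simp add: Rn_def)
    ultimately show ?thesis by (auto simp: space_leb)
  qed
  finally show ?thesis .
qed

lemma abs_component_le_enorm: "i < d \<Longrightarrow> \<bar>x i\<bar> \<le> enorm d x"
  unfolding enorm_def using member_le_L2_set[of "{..<d}" i "\<lambda>i. \<bar>x i\<bar>"]
  by (simp add: L2_set_def)

lemma abs_dotp_le: "\<bar>dotp d x y\<bar> \<le> enorm d x * enorm d y"
proof -
  have "\<bar>dotp d x y\<bar> \<le> (\<Sum>i<d. \<bar>x i\<bar> * \<bar>y i\<bar>)"
    unfolding dotp_def by (rule order.trans[OF sum_abs]) (simp add: abs_mult)
  also have "\<dots> \<le> enorm d x * enorm d y" unfolding enorm_def by (rule L2_set_mult_ineq)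
  finally show ?thesis .
qed

lemma bounded_domain_sets:
  assumes "bounded_domain d S"
  shows "S \<in> sets (leb d)"
  using assms openin_imp_sets_leb by (simp add: bounded_domain_def)

lemma bounded_domain_finite:
  assumes "bounded_domain d S"
  shows "emeasure (leb d) S < \<infinity>"
proof -
  obtain B where B: "\<And>x. x \<in> S \<Longrightarrow> enorm d x \<le> B" and S: "openin (powertop_real {..<d}) S"
    using assms by (auto simp: bounded_domain_def)
  have "S \<subseteq> cuboid d (\<lambda>_. - B) (\<lambda>_. B)"
  proof
    fix x assume x: "x \<in> S"
    have "\<bar>x i\<bar> \<le> B" if "i < d" for i using abs_component_le_enorm[OF that, of x] B[OF x] by linarith
    then show "x \<in> cuboid d (\<lambda>_. - B) (\<lambda>_. B)"
      using x openin_subset[OF S] by (auto simp: PiE_iff abs_le_iff minus_le_iff)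
  qed
  then have "emeasure (leb d) S \<le> emeasure (leb d) (cuboid d (\<lambda>_. - B) (\<lambda>_. B))"
    by (rule emeasure_mono) (rule sets_cuboid)
  then show ?thesis
    using emeasure_cuboid_finite by (rule le_less_trans)
qed

text \<open>A supremum of reals bounds its members only for sets bounded above; boundedness of the
  domain guarantees this.\<close>

lemma bounded_domain_diam:
  assumes S: "bounded_domain d S" and xy: "x \<in> S" "y \<in> S"
  shows "enorm d (\<lambda>i. x i - y i) \<le> ediam d S"
proof -
  obtain B where B: "\<And>x. x \<in> S \<Longrightarrow> enorm d x \<le> B"
    using S by (auto simp: bounded_domain_def)
  have tri: "enorm d (\<lambda>i. x i - y i) \<le> enorm d x + enorm d y" for x y
    using L2_set_triangle_ineq[of x "\<lambda>i. - y i" "{..<d}"] by (simp add: enorm_def L2_set_def)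
  have "bdd_above ((\<lambda>(x, y). enorm d (\<lambda>i. x i - y i)) ` (S \<times> S))"
  proof (rule bdd_aboveI[of _ "B + B"], safe)
    fix x y assume "x \<in> S" "y \<in> S"
    then show "enorm d (\<lambda>i. x i - y i) \<le> B + B" using tri[of x y] B[of x] B[of y] by linarith
  qed
  then show ?thesis
    unfolding ediam_def using xy cSUP_upper[of "(x, y)" "S \<times> S" "\<lambda>(x, y). enorm d (\<lambda>i. x i - y i)"] by auto
qed

section \<open>Bias and sampling error of a random ridge network\<close>

text \<open>\<open>l\<close> and \<open>n\<close> are still independent here: the first summand is
  the bias of the ridge representation, the second the sampling variance, and the factor 2 comes
  from \<open>(u - v)^2 \<le> 2 u^2 + 2 v^2\<close>. The dimension enters neither summand
  explicitly.\<close>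

lemma ridge_network_approximation:
  fixes s \<sigma> :: "real \<Rightarrow> real" and k :: "real \<Rightarrow> complex"
  assumes s: "integrable lborel s" and s2: "integrable lborel (\<lambda>t. (s t)\<^sup>2)"
    and \<sigma>s: "AE t in lborel. \<sigma> t = s t"
    and a: "a \<noteq> 0" and l: "l > 0" and k[measurable]: "k \<in> borel_measurable borel"
    and kb: "\<And>b. norm (k b) \<le> Bk"
    and k2: "(\<integral>\<^sup>+b. ennreal ((norm (k b))\<^sup>2) \<partial>lborel) \<le> ennreal K2" and K2: "K2 \<ge> 0"
    and rep: "\<And>t. norm ((\<integral>b. s (t + b) *\<^sub>R k b \<partial>lborel) - iexp (- (a * t))) \<le> \<bar>t\<bar> / l"
    and G: "integrable (leb d) G" and GB: "integrable (leb d) (\<lambda>w. (1 + enorm d w) * norm (G w))"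
    and \<Omega>[measurable]: "\<Omega> \<in> sets (leb d)" and \<Omega>fin: "emeasure (leb d) \<Omega> < \<infinity>"
    and diam: "\<And>x. x \<in> \<Omega> \<Longrightarrow> enorm d (\<lambda>i. x i - x0 i) \<le> D"
    and n: "n > 0"
  defines "B \<equiv> \<integral>w. (1 + enorm d w) * norm (G w) \<partial>leb d"
  shows "\<exists>g\<in>shallow_nets \<sigma> d n.
    (\<integral>\<^sup>+x\<in>\<Omega>. ennreal ((Re (\<integral>w. G w * iexp (dotp d w x) \<partial>leb d) - g x)\<^sup>2) \<partial>leb d)
     \<le> ennreal (measure (leb d) \<Omega> * (2 * ((D * B / (\<bar>a\<bar> * l))\<^sup>2 + K2 * B\<^sup>2 * (\<integral>t. (s t)\<^sup>2 \<partial>lborel) / real n)))"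
proof -
  let ?R = "lborel :: real measure"
  let ?M = "leb d \<Otimes>\<^sub>M ?R"
  interpret R: pair_sigma_finite "leb d" ?R
    using sigma_finite_leb sigma_finite_lborel by (simp add: pair_sigma_finite_def)
  have sfM: "sigma_finite_measure ?M" by (rule R.P.sigma_finite_measure_axioms)
  interpret MR: pair_sigma_finite ?M "leb d"
    using sigma_finite_leb sfM by (simp add: pair_sigma_finite_def)
  have [measurable]: "s \<in> borel_measurable borel" "G \<in> borel_measurable (leb d)" using s G by auto
  define A where "A = (\<integral>t. (s t)\<^sup>2 \<partial>lborel)"
  define g1 where "g1 = (\<integral>w. norm (G w) \<partial>leb d)"
  have A0: "0 \<le> A" and g10: "0 \<le> g1" unfolding A_def g1_def by (auto intro!: Bochner_Integration.integral_nonneg)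
  have g1B: "g1 \<le> B"
    unfolding g1_def B_def
  proof (rule integral_mono[OF _ GB])
    show "norm (G w) \<le> (1 + enorm d w) * norm (G w)" for w
      using enorm_nonneg[of d w] by (simp add: distrib_right)
  qed (use G in auto)
  have B0: "0 \<le> B" using g10 g1B by simp
  have k2int: "integrable lborel (\<lambda>b. (norm (k b))\<^sup>2)"
    using k2 by (intro integrableI_bounded) (auto intro: le_less_trans)
  define \<kappa> where "\<kappa> = (\<integral>b. (norm (k b))\<^sup>2 \<partial>lborel)"
  have \<kappa>: "0 \<le> \<kappa>" "\<kappa> \<le> K2"
    using k2 K2 nn_integral_eq_integral[OF k2int] by (auto simp: \<kappa>_def)

  \<comment> \<open>Neurons are indexed by a frequency and a bias, sampled with density \<open>q / Z\<close>. Taking \<open>q\<close>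
    quadratic in \<open>k\<close> bounds the variance by the \<open>L\<^sup>2\<close> norms of \<open>k\<close> and \<open>s\<close>.\<close>
  define T where "T = (\<lambda>w x. - (dotp d w x - dotp d w x0) / a)"
  \<comment> \<open>The phase at \<open>x0\<close> undoes the centring of \<open>T\<close>. Centring
    gives \<open>|T w x| \<le> D * enorm d w / |a|\<close> on the domain, so positions matter only
    relative to \<open>x0\<close>.\<close>
  define c where "c = (\<lambda>\<theta>. G (fst \<theta>) * iexp (dotp d (fst \<theta>) x0) * k (snd \<theta>))"
  define q where "q = (\<lambda>\<theta>. norm (G (fst \<theta>)) * (norm (k (snd \<theta>)))\<^sup>2)"
  define Z where "Z = g1 * \<kappa>"
  define \<Phi> where "\<Phi> = (\<lambda>x. \<integral>\<theta>. Re (c \<theta>) * s (T (fst \<theta>) x + snd \<theta>) \<partial>?M)"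
  define F where "F = (\<lambda>x. \<integral>w. G w * iexp (dotp d w x) \<partial>leb d)"
  have cm[measurable]: "c \<in> borel_measurable ?M" unfolding c_def by measurable
  have qm[measurable]: "q \<in> borel_measurable ?M" unfolding q_def by measurable
  have q0: "0 \<le> q \<theta>" for \<theta> by (simp add: q_def)
  have cq: "(norm (c \<theta>))\<^sup>2 = norm (G (fst \<theta>)) * q \<theta>" for \<theta>
    by (simp add: c_def q_def norm_mult power_mult_distrib power2_eq_square)
  have c0: "c \<theta> = 0" if "q \<theta> = 0" for \<theta> using cq[of \<theta>] that by simp
  have Tm[measurable]: "(\<lambda>z. T (fst (fst z)) (snd z)) \<in> borel_measurable (?M \<Otimes>\<^sub>M leb d)"
    unfolding T_def by measurable
  have Tm2[measurable]: "(\<lambda>z. T (fst (snd z)) (fst z)) \<in> borel_measurable (leb d \<Otimes>\<^sub>M ?M)"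
    unfolding T_def by measurable
  have Tm'[measurable]: "(\<lambda>\<theta>. T (fst \<theta>) x) \<in> borel_measurable ?M" "(\<lambda>w. T w x) \<in> borel_measurable (leb d)"
      "T w \<in> borel_measurable (leb d)" for x w
    unfolding T_def[abs_def] by measurable
  have qint: "integrable ?M q" and qZ: "(\<integral>\<theta>. q \<theta> \<partial>?M) = Z"
  proof -
    show i: "integrable ?M q" unfolding q_def
      by (rule integrable_mult_fst_snd[OF sigma_finite_leb sigma_finite_lborel])
         (use G k2int in auto)
    show "(\<integral>\<theta>. q \<theta> \<partial>?M) = Z"
      unfolding R.integral_fst'[OF i, symmetric] by (simp add: q_def Z_def g1_def \<kappa>_def)
  qed
  have shift: "integrable lborel (\<lambda>b. s (t + b))" for t
    using lborel_integrable_real_affine[OF s, of 1 t] by simp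
  \<comment> \<open>The supremum bound on \<open>k\<close> is spent here: with \<open>s\<close> in
    L1 and its translates of equal norm, it makes the integrand absolutely integrable over frequency
    and bias.\<close>
  have cint: "integrable ?M (\<lambda>\<theta>. c \<theta> * of_real (s (T (fst \<theta>) x + snd \<theta>)))" for x
  proof (rule R.Fubini_integrable)
    have bd: "norm (c (w, b) * of_real (s (T w x + b))) \<le> norm (norm (G w) * Bk * s (T w x + b))" for w b
      using kb[of b] order.trans[OF norm_ge_zero kb[of b]]
      by (auto simp: c_def norm_mult abs_mult intro!: mult_mono)
    have i: "integrable lborel (\<lambda>b. norm (G w) * Bk * s (T w x + b))" for w
      using shift by auto
    have i': "integrable lborel (\<lambda>b. c (w, b) * of_real (s (T w x + b)))" for w
      by (rule Bochner_Integration.integrable_bound[OF i]) (use bd in \<open>auto simp: c_def\<close>)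
    show "AE w in leb d. integrable lborel (\<lambda>b. c (w, b) * of_real (s (T (fst (w, b)) x + snd (w, b))))"
      using i' by simp
    have "integrable (leb d) (\<lambda>w. norm (G w) * (Bk * (\<integral>b. \<bar>s b\<bar> \<partial>lborel)))" using G by auto
    then show "integrable (leb d) (\<lambda>w. \<integral>b. norm (c (w, b) * of_real (s (T (fst (w, b)) x + snd (w, b)))) \<partial>lborel)"
    proof (rule Bochner_Integration.integrable_bound)
      show "(\<lambda>w. \<integral>b. norm (c (w, b) * of_real (s (T (fst (w, b)) x + snd (w, b)))) \<partial>lborel) \<in> borel_measurable (leb d)"
        by measurable
      have "(\<integral>b. norm (c (w, b) * of_real (s (T w x + b))) \<partial>lborel) \<le> norm (G w) * (Bk * (\<integral>b. \<bar>s b\<bar> \<partial>lborel))" for w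
      proof -
        have "(\<integral>b. norm (c (w, b) * of_real (s (T w x + b))) \<partial>lborel) \<le> (\<integral>b. norm (norm (G w) * Bk * s (T w x + b)) \<partial>lborel)"
          using i i' bd by (intro integral_mono integrable_norm) auto
        also have "\<dots> = norm (G w) * (Bk * (\<integral>b. \<bar>s (T w x + b)\<bar> \<partial>lborel))"
          using order.trans[OF norm_ge_zero kb[of 0]] by (simp add: abs_mult)
        also have "(\<integral>b. \<bar>s (T w x + b)\<bar> \<partial>lborel) = (\<integral>b. \<bar>s b\<bar> \<partial>lborel)"
          using lborel_integral_real_affine[of 1 "\<lambda>b. \<bar>s b\<bar>" "T w x"] by simp
        finally show ?thesis .
      qed
      then show "AE w in leb d. norm (\<integral>b. norm (c (w, b) * of_real (s (T (fst (w, b)) x + snd (w, b)))) \<partial>lborel)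
          \<le> norm (norm (G w) * (Bk * (\<integral>b. \<bar>s b\<bar> \<partial>lborel)))"
        by (intro AE_I2) (simp add: order.trans[OF _ abs_ge_self])
    qed
  qed measurable
  have bias: "\<bar>Re (F x) - \<Phi> x\<bar> \<le> D * B / (\<bar>a\<bar> * l)" if x: "x \<in> \<Omega>" for x
  proof -
    have iG: "integrable (leb d) (\<lambda>w. G w * iexp (dotp d w x))"
    proof -
      have "(\<lambda>w. dotp d w x) \<in> borel_measurable (leb d)" by measurable
      then show ?thesis
        by (intro Bochner_Integration.integrable_bound[OF G]) (auto simp: norm_mult)
    qed
    have "\<Phi> x = Re (\<integral>\<theta>. c \<theta> * of_real (s (T (fst \<theta>) x + snd \<theta>)) \<partial>?M)"
      unfolding \<Phi>_def integral_Re[OF cint, symmetric] by simp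
    also have "(\<integral>\<theta>. c \<theta> * of_real (s (T (fst \<theta>) x + snd \<theta>)) \<partial>?M)
        = (\<integral>w. \<integral>b. c (w, b) * of_real (s (T w x + b)) \<partial>lborel \<partial>leb d)"
      using R.integral_fst'[OF cint] by simp
    also have "\<dots> = (\<integral>w. G w * iexp (dotp d w x0) * (\<integral>b. s (T w x + b) *\<^sub>R k b \<partial>lborel) \<partial>leb d)"
      by (subst integral_mult_right_zero[symmetric]) (simp add: c_def scaleR_conv_of_real mult_ac)
    finally have \<Phi>: "\<Phi> x = Re (\<integral>w. G w * iexp (dotp d w x0) * (\<integral>b. s (T w x + b) *\<^sub>R k b \<partial>lborel) \<partial>leb d)" .
    have iS: "integrable (leb d) (\<lambda>w. G w * iexp (dotp d w x0) * (\<integral>b. s (T w x + b) *\<^sub>R k b \<partial>lborel))"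
      using R.integrable_fst'[OF cint[of x]]
      by (subst integral_mult_right_zero[symmetric]) (simp add: c_def scaleR_conv_of_real mult_ac)
    have "\<bar>Re (F x) - \<Phi> x\<bar> \<le> norm ((\<integral>w. G w * iexp (dotp d w x) \<partial>leb d)
          - (\<integral>w. G w * iexp (dotp d w x0) * (\<integral>b. s (T w x + b) *\<^sub>R k b \<partial>lborel) \<partial>leb d))"
      unfolding \<Phi> F_def minus_complex.sel(1)[symmetric] by (rule abs_Re_le_cmod)
    also have "\<dots> = norm (\<integral>w. G w * iexp (dotp d w x)
          - G w * iexp (dotp d w x0) * (\<integral>b. s (T w x + b) *\<^sub>R k b \<partial>lborel) \<partial>leb d)"
      by (subst Bochner_Integration.integral_diff[OF iG iS]) simp
    also have "\<dots> \<le> (\<integral>w. D / (\<bar>a\<bar> * l) * ((1 + enorm d w) * norm (G w)) \<partial>leb d)"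
    proof (rule order.trans[OF integral_norm_bound], rule integral_mono)
      fix w
      have "- (a * T w x) = dotp d w x - dotp d w x0" using a by (simp add: T_def)
      then have "iexp (dotp d w x) = iexp (dotp d w x0) * iexp (- (a * T w x))"
        by (simp only: exp_add[symmetric] distrib_left[symmetric] of_real_add[symmetric]) simp
      then have "G w * iexp (dotp d w x) - G w * iexp (dotp d w x0) * (\<integral>b. s (T w x + b) *\<^sub>R k b \<partial>lborel)
         = - (G w * iexp (dotp d w x0) * ((\<integral>b. s (T w x + b) *\<^sub>R k b \<partial>lborel) - iexp (- (a * T w x))))"
        by (simp only: right_diff_distrib mult.assoc minus_diff_eq)
      then have "norm (G w * iexp (dotp d w x) - G w * iexp (dotp d w x0) * (\<integral>b. s (T w x + b) *\<^sub>R k b \<partial>lborel))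
         = norm (G w) * norm ((\<integral>b. s (T w x + b) *\<^sub>R k b \<partial>lborel) - iexp (- (a * T w x)))"
        by (simp add: norm_mult)
      also have "\<dots> \<le> norm (G w) * ((1 + enorm d w) * D / \<bar>a\<bar> / l)"
      proof (rule mult_left_mono[OF order.trans[OF rep]])
        have "\<bar>dotp d w x - dotp d w x0\<bar> = \<bar>dotp d w (\<lambda>i. x i - x0 i)\<bar>"
          by (simp add: dotp_def right_diff_distrib sum_subtractf)
        also have "\<dots> \<le> enorm d w * D"
          using abs_dotp_le mult_left_mono[OF diam[OF x] enorm_nonneg] by (rule order.trans)
        also have "\<dots> \<le> (1 + enorm d w) * D"
          using enorm_nonneg[of d "\<lambda>i. x i - x0 i"] diam[OF x] by (intro mult_right_mono) auto
        finally have "\<bar>T w x\<bar> \<le> (1 + enorm d w) * D / \<bar>a\<bar>"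
          by (simp add: T_def abs_minus_commute divide_right_mono)
        then show "\<bar>T w x\<bar> / l \<le> (1 + enorm d w) * D / \<bar>a\<bar> / l"
          using l by (intro divide_right_mono) auto
      qed simp
      finally show "norm (G w * iexp (dotp d w x) - G w * iexp (dotp d w x0) * (\<integral>b. s (T w x + b) *\<^sub>R k b \<partial>lborel))
          \<le> D / (\<bar>a\<bar> * l) * ((1 + enorm d w) * norm (G w))"
        by (simp add: mult_ac)
    qed (use iG iS GB in auto)
    also have "\<dots> = D * B / (\<bar>a\<bar> * l)" by (simp add: B_def)
    finally show ?thesis .
  qed
  have [measurable]: "\<Phi> \<in> borel_measurable (leb d)"
    unfolding \<Phi>_def by (rule sigma_finite_measure.borel_measurable_lebesgue_integral[OF sfM])
      (unfold split_beta', measurable)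

  \<comment> \<open>A density instead of a restricted space keeps the sigma-algebra of
    \<open>leb d\<close>, so measurability facts carry over unchanged.\<close>
  let ?N = "density (leb d) (indicator \<Omega>)"
  have Nm: "emeasure ?N (space ?N) = emeasure (leb d) \<Omega>"
    by (subst emeasure_density) (auto intro!: nn_integral_cong simp: nn_integral_indicator[symmetric] simp del: nn_integral_indicator split: split_indicator)
  have finN: "finite_measure ?N"
    using \<Omega>fin Nm by (intro finite_measureI) auto
  have mN: "measure ?N (space ?N) = measure (leb d) \<Omega>"
    using Nm by (simp add: measure_def)
  \<comment> \<open>\<open>T\<close> is affine in \<open>x\<close>: the weight is
    \<open>- w / a\<close>, cut down to the extensional carrier, and the contribution of
    \<open>x0\<close> joins the bias.\<close>
  have netI: "(\<lambda>x. \<Sum>i<n. \<beta> i * \<sigma> (T (fst (\<theta> i)) x + snd (\<theta> i))) \<in> shallow_nets \<sigma> d n" for \<beta> and \<theta> :: "nat \<Rightarrow> (nat \<Rightarrow> real) \<times> real"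
  proof -
    define W where "W = (\<lambda>i. restrict (\<lambda>j. - fst (\<theta> i) j / a) {..<d})"
    have eq: "T (fst (\<theta> i)) x + snd (\<theta> i) = dotp d (W i) x + (snd (\<theta> i) + dotp d (fst (\<theta> i)) x0 / a)" for i x
      using a by (simp add: T_def W_def dotp_def sum_negf sum_divide_distrib diff_divide_distrib)
    have "W i \<in> Rn d" for i by (simp add: W_def Rn_def)
    then show ?thesis
      unfolding shallow_nets_def eq
      by (intro CollectI exI[of _ W] exI[of _ "\<lambda>i. snd (\<theta> i) + dotp d (fst (\<theta> i)) x0 / a"] exI[of _ \<beta>] conjI refl) auto
  qed
  \<comment> \<open>Bounds the second moment of one sampled neuron. One factor \<open>q\<close> of
    the squared coefficient cancels, leaving the integrand at most
    \<open>Z * norm (G w) * s^2\<close>, whose integral is \<open>Z * (g1 * A)\<close> by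
    translation invariance in the bias.\<close>
  define S where "S = Z * (g1 * A)"
  have S0: "0 \<le> S" using \<kappa> g10 A0 by (simp add: S_def Z_def)
  have "\<exists>g\<in>shallow_nets \<sigma> d n. \<exists>g'\<in>borel_measurable (leb d). (AE x in leb d. g x = g' x) \<and>
     (\<integral>\<^sup>+x\<in>\<Omega>. ennreal ((g' x - \<Phi> x)\<^sup>2) \<partial>leb d) \<le> ennreal (S * measure (leb d) \<Omega> / real n)"
  proof (cases "Z = 0")
    \<comment> \<open>There is no density to sample from, but then the coefficients vanish almost
      everywhere, \<open>\<Phi>\<close> is 0, and the zero network is exact.\<close>
    case True
    then have "AE \<theta> in ?M. q \<theta> = 0"
      using integral_nonneg_eq_0_iff_AE[OF qint] q0 qZ by auto
    then have "AE \<theta> in ?M. c \<theta> = 0"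
      by eventually_elim (rule c0)
    then have "\<Phi> x = 0" for x
      unfolding \<Phi>_def by (intro integral_eq_zero_AE) (auto elim!: AE_mp)
    then show ?thesis
      by (intro bexI[OF _ netI[of "\<lambda>_. 0" "\<lambda>_. (\<lambda>_. 0, 0)"]] bexI[of _ "\<lambda>_. 0"]) auto
  next
    case False
    then have Z: "Z > 0" using \<kappa> g10 by (simp add: Z_def order.strict_iff_order)
    define P where "P = density ?M (\<lambda>\<theta>. ennreal (q \<theta> / Z))"
    have PM: "sets P = sets ?M" "space P = space ?M" by (auto simp: P_def)
    interpret P: prob_space P
    proof (rule prob_spaceI)
      have "emeasure P (space P) = (\<integral>\<^sup>+\<theta>. ennreal (q \<theta> / Z) \<partial>?M)"
        unfolding PM(2) unfolding P_def
        by (subst emeasure_density[OF _ sets.top]) (auto intro!: nn_integral_cong)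
      also have "\<dots> = ennreal (\<integral>\<theta>. q \<theta> / Z \<partial>?M)"
        using qint q0 Z by (intro nn_integral_eq_integral) auto
      finally show "emeasure P (space P) = 1" using qZ Z by simp
    qed
    \<comment> \<open>Importance weighting: division by the density \<open>q / Z\<close> makes the
      mean under \<open>P\<close> equal to \<open>\<Phi> x\<close>. Where \<open>q\<close> is 0 the
      quotient is 0 by convention, which is harmless since \<open>c\<close> vanishes there as
      well.\<close>
    define V where "V = (\<lambda>\<theta> x. Z * Re (c \<theta>) / q \<theta> * s (T (fst \<theta>) x + snd \<theta>))"
    have Vm: "(\<lambda>(\<theta>, x). V \<theta> x) \<in> borel_measurable (P \<Otimes>\<^sub>M ?N)"
    proof -
      have "(\<lambda>(\<theta>, x). V \<theta> x) \<in> borel_measurable (?M \<Otimes>\<^sub>M leb d)"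
        unfolding V_def split_beta' by measurable
      also have "borel_measurable (?M \<Otimes>\<^sub>M leb d) = borel_measurable (P \<Otimes>\<^sub>M ?N)"
        by (intro measurable_cong_sets sets_pair_measure_cong) (auto simp: PM)
      finally show ?thesis .
    qed
    have Vm'[measurable]: "(\<lambda>\<theta>. V \<theta> x) \<in> borel_measurable ?M" for x
      unfolding V_def by measurable
    have EV: "(\<integral>\<theta>. V \<theta> x \<partial>P) = \<Phi> x" for x
    proof -
      have "(\<integral>\<theta>. V \<theta> x \<partial>P) = (\<integral>\<theta>. (q \<theta> / Z) *\<^sub>R V \<theta> x \<partial>?M)"
        unfolding P_def using q0 Z by (intro integral_density) auto
      also have "\<dots> = \<Phi> x"
        unfolding \<Phi>_def
      proof (rule Bochner_Integration.integral_cong[OF refl])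
        fix \<theta>
        show "(q \<theta> / Z) *\<^sub>R V \<theta> x = Re (c \<theta>) * s (T (fst \<theta>) x + snd \<theta>)"
          using Z c0[of \<theta>] by (cases "q \<theta> = 0") (auto simp: V_def)
      qed
      finally show ?thesis .
    qed
    have EV2: "(\<integral>\<^sup>+\<theta>. ennreal ((V \<theta> x)\<^sup>2) \<partial>P) \<le> ennreal S" for x
    proof -
      have "(\<integral>\<^sup>+\<theta>. ennreal ((V \<theta> x)\<^sup>2) \<partial>P) = (\<integral>\<^sup>+\<theta>. ennreal (q \<theta> / Z) * ennreal ((V \<theta> x)\<^sup>2) \<partial>?M)"
        unfolding P_def by (rule nn_integral_density) auto
      also have "\<dots> \<le> (\<integral>\<^sup>+\<theta>. ennreal Z * (ennreal (norm (G (fst \<theta>))) * ennreal ((s (T (fst \<theta>) x + snd \<theta>))\<^sup>2)) \<partial>?M)"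
      proof (rule nn_integral_mono)
        fix \<theta>
        let ?s = "s (T (fst \<theta>) x + snd \<theta>)"
        have "q \<theta> / Z * (V \<theta> x)\<^sup>2 \<le> Z * (norm (G (fst \<theta>)) * ?s\<^sup>2)"
        proof (cases "q \<theta> = 0")
          case True
          then show ?thesis using Z by simp
        next
          case False
          have "(Re (c \<theta>))\<^sup>2 \<le> norm (G (fst \<theta>)) * q \<theta>"
            unfolding cq[symmetric] using abs_Re_le_cmod[of "c \<theta>"] by (simp add: abs_le_square_iff[symmetric])
          then have le: "Z * ?s\<^sup>2 / q \<theta> * (Re (c \<theta>))\<^sup>2 \<le> Z * ?s\<^sup>2 / q \<theta> * (norm (G (fst \<theta>)) * q \<theta>)"
            using Z q0[of \<theta>] by (intro mult_left_mono) auto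
          have "q \<theta> / Z * (V \<theta> x)\<^sup>2 = Z * ?s\<^sup>2 / q \<theta> * (Re (c \<theta>))\<^sup>2"
            using Z False by (simp add: V_def power2_eq_square field_simps)
          also note le
          also have "Z * ?s\<^sup>2 / q \<theta> * (norm (G (fst \<theta>)) * q \<theta>) = Z * (norm (G (fst \<theta>)) * ?s\<^sup>2)"
            using False by simp
          finally show ?thesis .
        qed
        then show "ennreal (q \<theta> / Z) * ennreal ((V \<theta> x)\<^sup>2) \<le> ennreal Z * (ennreal (norm (G (fst \<theta>))) * ennreal (?s\<^sup>2))"
          using Z q0[of \<theta>] by (simp add: ennreal_mult[symmetric] ennreal_leI)
      qed
      also have "\<dots> = ennreal Z * (\<integral>\<^sup>+w. \<integral>\<^sup>+b. ennreal (norm (G w)) * ennreal ((s (T w x + b))\<^sup>2) \<partial>lborel \<partial>leb d)"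
        by (subst nn_integral_cmult) (auto simp: lborel.nn_integral_fst[symmetric])
      also have "(\<lambda>w. \<integral>\<^sup>+b. ennreal (norm (G w)) * ennreal ((s (T w x + b))\<^sup>2) \<partial>lborel) = (\<lambda>w. ennreal (norm (G w)) * ennreal A)"
      proof
        fix w
        have "(\<integral>\<^sup>+b. ennreal ((s (T w x + b))\<^sup>2) \<partial>lborel) = (\<integral>\<^sup>+b. ennreal ((s b)\<^sup>2) \<partial>lborel)"
          using nn_integral_real_affine[of "\<lambda>b. ennreal ((s b)\<^sup>2)" 1 "T w x"] by simp
        also have "\<dots> = ennreal A" unfolding A_def by (rule nn_integral_eq_integral[OF s2]) auto
        finally show "(\<integral>\<^sup>+b. ennreal (norm (G w)) * ennreal ((s (T w x + b))\<^sup>2) \<partial>lborel) = ennreal (norm (G w)) * ennreal A"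
          by (simp add: nn_integral_cmult)
      qed
      also have "(\<integral>\<^sup>+w. ennreal (norm (G w)) * ennreal A \<partial>leb d) = ennreal g1 * ennreal A"
        unfolding g1_def using G by (simp add: nn_integral_multc nn_integral_eq_integral)
      also have "ennreal Z * (ennreal g1 * ennreal A) = ennreal S"
        using Z g10 A0 by (simp add: S_def ennreal_mult)
      finally show ?thesis .
    qed
    define Q where "Q = (\<lambda>\<theta>. AE x in leb d. \<sigma> (T (fst \<theta>) x + snd \<theta>) = s (T (fst \<theta>) x + snd \<theta>))"
    have "AE \<theta> in ?M. Q \<theta>"
    proof -
      obtain X where X: "X \<in> null_sets lborel" "{t \<in> space lborel. \<sigma> t \<noteq> s t} \<subseteq> X"
        using \<sigma>s by (auto elim!: AE_E simp: null_sets_def)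
      have [measurable]: "X \<in> sets borel" using X(1) by (auto simp: null_sets_def)
      \<comment> \<open>For fixed \<open>x\<close> and frequency, the bad biases form a translate of
        the null set \<open>X\<close>, even when the frequency is 0. Fubini then exchanges "almost
        every parameter" with "almost every point".\<close>
      have 1: "AE \<theta> in ?M. T (fst \<theta>) x + snd \<theta> \<notin> X" for x
      proof (rule R.AE_pair_measure)
        show "{\<theta> \<in> space ?M. T (fst \<theta>) x + snd \<theta> \<notin> X} \<in> sets ?M" by measurable
        have "AE b in lborel. t + 1 * b \<notin> X" for t
          using AE_not_in[OF X(1)] by (intro AE_borel_affine) auto
        then show "AE w in leb d. AE b in lborel. T (fst (w, b)) x + snd (w, b) \<notin> X" by simp
      qed
      have "AE \<theta> in ?M. AE x in leb d. T (fst \<theta>) x + snd \<theta> \<notin> X"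
      proof -
        have "{z \<in> space (?M \<Otimes>\<^sub>M leb d). T (fst (fst z)) (snd z) + snd (fst z) \<notin> X} \<in> sets (?M \<Otimes>\<^sub>M leb d)"
          by measurable
        from MR.AE_commute[OF this] show ?thesis using 1 by simp
      qed
      then show ?thesis
        unfolding Q_def by eventually_elim (use X(2) in \<open>auto elim!: eventually_mono\<close>)
    qed
    then have PQ: "AE \<theta> in P. Q \<theta>" unfolding P_def by (subst AE_density) auto
    obtain \<theta> where \<theta>: "\<And>i. i < n \<Longrightarrow> \<theta> i \<in> space P \<and> Q (\<theta> i)"
      and le: "(\<integral>\<^sup>+x. ennreal (((\<Sum>i<n. V (\<theta> i) x) / real n - \<Phi> x)\<^sup>2) \<partial>?N) \<le> ennreal (S * measure ?N (space ?N) / real n)"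
      using monte_carlo_L2[OF P.prob_space_axioms finN Vm S0 EV2 PQ n] unfolding EV by blast
    define \<beta> where "\<beta> = (\<lambda>i. Z * Re (c (\<theta> i)) / q (\<theta> i) / real n)"
    define g' where "g' = (\<lambda>x. (\<Sum>i<n. V (\<theta> i) x) / real n)"
    have g'm[measurable]: "g' \<in> borel_measurable (leb d)"
      unfolding g'_def V_def by measurable
    have "AE x in leb d. \<forall>i<n. \<sigma> (T (fst (\<theta> i)) x + snd (\<theta> i)) = s (T (fst (\<theta> i)) x + snd (\<theta> i))"
      using \<theta> unfolding Q_def by (subst AE_all_countable) auto
    then have ae: "AE x in leb d. (\<Sum>i<n. \<beta> i * \<sigma> (T (fst (\<theta> i)) x + snd (\<theta> i))) = g' x"
      by eventually_elim (auto simp: g'_def \<beta>_def V_def sum_divide_distrib intro!: sum.cong)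
    have "(\<integral>\<^sup>+x\<in>\<Omega>. ennreal ((g' x - \<Phi> x)\<^sup>2) \<partial>leb d) = (\<integral>\<^sup>+x. ennreal ((g' x - \<Phi> x)\<^sup>2) \<partial>?N)"
      by (subst nn_integral_density) (auto simp: mult.commute)
    also have "\<dots> \<le> ennreal (S * measure (leb d) \<Omega> / real n)" using le unfolding g'_def mN .
    finally show ?thesis
      by (intro bexI[OF _ netI[of \<beta> \<theta>]] bexI[OF _ g'm] conjI ae)
  qed
  then obtain g g' where g: "g \<in> shallow_nets \<sigma> d n" and g'[measurable]: "g' \<in> borel_measurable (leb d)"
    and gg': "AE x in leb d. g x = g' x"
    and le: "(\<integral>\<^sup>+x\<in>\<Omega>. ennreal ((g' x - \<Phi> x)\<^sup>2) \<partial>leb d) \<le> ennreal (S * measure (leb d) \<Omega> / real n)"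
    by blast
  define \<delta> where "\<delta> = D * B / (\<bar>a\<bar> * l)"
  have "(\<integral>\<^sup>+x\<in>\<Omega>. ennreal ((Re (F x) - g x)\<^sup>2) \<partial>leb d)
      \<le> (\<integral>\<^sup>+x. ennreal (2 * \<delta>\<^sup>2) * indicator \<Omega> x + 2 * (ennreal ((g' x - \<Phi> x)\<^sup>2) * indicator \<Omega> x) \<partial>leb d)"
  proof (rule nn_integral_mono_AE)
    show "AE x in leb d. ennreal ((Re (F x) - g x)\<^sup>2) * indicator \<Omega> x
        \<le> ennreal (2 * \<delta>\<^sup>2) * indicator \<Omega> x + 2 * (ennreal ((g' x - \<Phi> x)\<^sup>2) * indicator \<Omega> x)"
      using gg'
    proof eventually_elim
      case (elim x)
      show ?case
      proof (cases "x \<in> \<Omega>")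
        case True
        have "(Re (F x) - g x)\<^sup>2 = ((Re (F x) - \<Phi> x) - (g' x - \<Phi> x))\<^sup>2" using elim by simp
        also have "\<dots> \<le> 2 * (Re (F x) - \<Phi> x)\<^sup>2 + 2 * (g' x - \<Phi> x)\<^sup>2"
          using zero_le_power2[of "(Re (F x) - \<Phi> x) + (g' x - \<Phi> x)"] by (simp add: power2_eq_square algebra_simps)
        also have "(Re (F x) - \<Phi> x)\<^sup>2 \<le> \<delta>\<^sup>2"
          using power_mono[OF bias[OF True], of 2] by (simp add: \<delta>_def)
        finally have "ennreal ((Re (F x) - g x)\<^sup>2) \<le> ennreal (2 * \<delta>\<^sup>2 + 2 * (g' x - \<Phi> x)\<^sup>2)"
          by (intro ennreal_leI) simp
        then show ?thesis using True by (simp add: ennreal_mult)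
      qed simp
    qed
  qed
  also have "\<dots> = ennreal (2 * \<delta>\<^sup>2) * emeasure (leb d) \<Omega> + 2 * (\<integral>\<^sup>+x\<in>\<Omega>. ennreal ((g' x - \<Phi> x)\<^sup>2) \<partial>leb d)"
    by (subst nn_integral_add) (auto simp: nn_integral_cmult nn_integral_cmult_indicator)
  also have "\<dots> \<le> ennreal (2 * \<delta>\<^sup>2) * emeasure (leb d) \<Omega> + 2 * ennreal (S * measure (leb d) \<Omega> / real n)"
    by (intro add_left_mono mult_left_mono le) simp
  also have "\<dots> = ennreal (2 * \<delta>\<^sup>2 * measure (leb d) \<Omega> + 2 * (S * measure (leb d) \<Omega> / real n))"
  proof -
    have "ennreal x * ennreal m + 2 * ennreal v = ennreal (x * m + 2 * v)" if "0 \<le> x" "0 \<le> m" "0 \<le> v" for x m v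
      using that by (simp add: ennreal_mult)
    moreover have "emeasure (leb d) \<Omega> = ennreal (measure (leb d) \<Omega>)"
      using \<Omega>fin by (intro emeasure_eq_ennreal_measure) auto
    moreover have "0 \<le> S * measure (leb d) \<Omega> / real n" using S0 by simp
    ultimately show ?thesis by (metis measure_nonneg mult_nonneg_nonneg zero_le_numeral zero_le_power2)
  qed
  also have "\<dots> \<le> ennreal (measure (leb d) \<Omega> * (2 * (\<delta>\<^sup>2 + K2 * B\<^sup>2 * A / real n)))"
  proof (rule ennreal_leI)
    have "S = g1 * g1 * \<kappa> * A" by (simp add: S_def Z_def)
    also have "\<dots> \<le> B * B * K2 * A"
      using g1B g10 \<kappa> A0 by (intro mult_mono mult_nonneg_nonneg) auto
    finally have "S / real n \<le> K2 * B\<^sup>2 * A / real n"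
      by (intro divide_right_mono) (auto simp: power2_eq_square mult_ac)
    then have "measure (leb d) \<Omega> * (2 * (\<delta>\<^sup>2 + S / real n)) \<le> measure (leb d) \<Omega> * (2 * (\<delta>\<^sup>2 + K2 * B\<^sup>2 * A / real n))"
      by (intro mult_left_mono) auto
    then show "2 * \<delta>\<^sup>2 * measure (leb d) \<Omega> + 2 * (S * measure (leb d) \<Omega> / real n)
        \<le> measure (leb d) \<Omega> * (2 * (\<delta>\<^sup>2 + K2 * B\<^sup>2 * A / real n))"
      by (simp add: algebra_simps)
  qed
  finally show ?thesis using g unfolding \<delta>_def A_def F_def by blast
qed

section \<open>Barron functions and the final rate\<close>

lemma borel_representative_complex:
  fixes g :: "(nat \<Rightarrow> real) \<Rightarrow> complex"
  assumes g: "g \<in> borel_measurable (lebesgue_Rn d)"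
  obtains G where "G \<in> borel_measurable (leb d)" "AE x in leb d. g x = G x"
proof -
  have "(\<lambda>x. Re (g x)) \<in> borel_measurable (lebesgue_Rn d)" "(\<lambda>x. Im (g x)) \<in> borel_measurable (lebesgue_Rn d)"
    using g by auto
  then obtain u v where [measurable]: "u \<in> borel_measurable (leb d)" "v \<in> borel_measurable (leb d)"
    and ae: "AE x in leb d. Re (g x) = u x" "AE x in leb d. Im (g x) = v x"
    unfolding lebesgue_Rn_def
    using completion_ex_borel_measurable_real[of "\<lambda>x. Re (g x)" "leb d"]
      completion_ex_borel_measurable_real[of "\<lambda>x. Im (g x)" "leb d"] by blast
  from ae have "AE x in leb d. g x = Complex (u x) (v x)"
    by eventually_elim (auto simp: complex_eq_iff)
  moreover have "(\<lambda>x. Complex (u x) (v x)) \<in> borel_measurable (leb d)"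
    unfolding Complex_eq by measurable
  ultimately show ?thesis using that by blast
qed

text \<open>Membership provides some transform, so the one picked by choice in
  \<open>fourier_transform\<close> is a transform too. Taking \<open>G\<close> as a Borel
  representative of that very function makes the formula for the norm an equality.\<close>

lemma barron_space_representation:
  assumes f: "f \<in> barron_space d 1"
  obtains G where "integrable (leb d) G" "integrable (leb d) (\<lambda>w. (1 + enorm d w) * norm (G w))"
    "barron_norm d 1 f = ennreal (\<integral>w. (1 + enorm d w) * norm (G w) \<partial>leb d)"
    "AE x in leb d. f x = Re (\<integral>w. G w * iexp (dotp d w x) \<partial>leb d)"
proof -
  let ?g = "fourier_transform d f"
  have "\<exists>g. has_fourier_transform d (\<lambda>x. of_real (f x)) g"
    using f by (simp add: barron_space_def)
  then have ft: "has_fourier_transform d (\<lambda>x. of_real (f x)) ?g"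
    unfolding fourier_transform_def by (rule someI_ex)
  have fin: "barron_norm d 1 f < \<infinity>" using f by (simp add: barron_space_def)
  have temp: "tempered_function d (\<lambda>x. complex_of_real (f x))" "tempered_function d ?g"
    using ft by (auto simp: has_fourier_transform_def)
  obtain G where Gm[measurable]: "G \<in> borel_measurable (leb d)" and gG: "AE w in leb d. ?g w = G w"
    using borel_representative_complex[OF tempered_function_measurable[OF temp(2)]] by blast
  obtain H where [measurable]: "H \<in> borel_measurable (leb d)" and fH: "AE x in leb d. complex_of_real (f x) = H x"
    using borel_representative_complex[OF tempered_function_measurable[OF temp(1)]] by blast
  define h where "h = (\<lambda>x. Re (H x))"
  have h: "h \<in> borel_measurable (leb d)" unfolding h_def by measurable
  have fh: "AE x in leb d. f x = h x"
    using fH by eventually_elim (metis Re_complex_of_real h_def)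
  have norm: "barron_norm d 1 f = (\<integral>\<^sup>+w. ennreal ((1 + enorm d w) * norm (G w)) \<partial>leb d)"
  proof -
    have "barron_norm d 1 f = (\<integral>\<^sup>+w. ennreal ((1 + enorm d w) powr 1 * norm (?g w)) \<partial>leb d)"
      unfolding barron_norm_def lebesgue_Rn_def by (rule nn_integral_completion)
    also have "\<dots> = (\<integral>\<^sup>+w. ennreal ((1 + enorm d w) * norm (G w)) \<partial>leb d)"
      by (rule nn_integral_cong_AE, rule eventually_mono[OF gG]) (simp add: enorm_nonneg add_nonneg_nonneg)
    finally show ?thesis .
  qed
  have GB: "integrable (leb d) (\<lambda>w. (1 + enorm d w) * norm (G w))"
    using fin unfolding norm by (intro integrableI_nonneg) (auto simp: enorm_nonneg add_nonneg_nonneg)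
  have G: "integrable (leb d) G"
  proof (rule Bochner_Integration.integrable_bound[OF GB])
    show "AE w in leb d. norm (G w) \<le> norm ((1 + enorm d w) * norm (G w))"
      by (intro AE_I2) (simp add: abs_mult enorm_nonneg distrib_right)
  qed measurable
  show ?thesis
  proof (rule that[OF G GB])
    show "barron_norm d 1 f = ennreal (\<integral>w. (1 + enorm d w) * norm (G w) \<partial>leb d)"
      unfolding norm by (rule nn_integral_eq_integral[OF GB]) (simp add: enorm_nonneg add_nonneg_nonneg)
    show "AE x in leb d. f x = Re (\<integral>w. G w * iexp (dotp d w x) \<partial>leb d)"
      using fourier_inversion_AE[OF ft h fh G gG] fh by eventually_elim simp
  qed
qed

text \<open>The constant is built from \<open>a\<close>, \<open>K\<close> and the squared L2 norm of
  \<open>s\<close>, all obtained before dimension, domain, target function and number of neurons are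
  introduced.\<close>

lemma shallow_network_rate:
  fixes s \<sigma> :: "real \<Rightarrow> real"
  assumes s: "integrable lborel s" and s2: "integrable lborel (\<lambda>t. (s t)\<^sup>2)"
    and nz: "\<not> (AE t in lborel. s t = 0)" and \<sigma>s: "AE t in lborel. \<sigma> t = s t"
  shows "\<exists>C :: real \<Rightarrow> real. \<forall>(d::nat) \<Omega> f (n::nat).
           d \<ge> 1 \<longrightarrow> bounded_domain d \<Omega> \<longrightarrow> f \<in> barron_space d 1 \<longrightarrow> n \<ge> 1 \<longrightarrow>
             (INF g\<in>shallow_nets \<sigma> d n. L2_norm_on d \<Omega> (\<lambda>x. f x - g x))
               \<le> ennreal (measure (lebesgue_Rn d) \<Omega> powr (1/2) * C (ediam d \<Omega>) * real n powr (- 1/4))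
                  * barron_norm d 1 f"
proof -
  obtain a K where a: "a \<noteq> 0" and K: "K \<ge> 0"
    and ridge: "\<And>l. l \<ge> 1 \<Longrightarrow> \<exists>k\<in>borel_measurable borel. (\<exists>B. \<forall>b. norm (k b) \<le> B) \<and>
        (\<integral>\<^sup>+b. ennreal ((norm (k b))\<^sup>2) \<partial>lborel) \<le> ennreal (K * l) \<and>
        (\<forall>t. norm ((\<integral>b. s (t + b) *\<^sub>R k b \<partial>lborel) - iexp (- (a * t))) \<le> \<bar>t\<bar> / l)"
    using ridge_exponential[OF s nz] by blast
  define A where "A = (\<integral>t. (s t)\<^sup>2 \<partial>lborel)"
  have A0: "A \<ge> 0" unfolding A_def by (rule Bochner_Integration.integral_nonneg) simp
  \<comment> \<open>The square of \<open>C D\<close> is what remains of the bound in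
    \<open>ridge_network_approximation\<close>, with kernel bound \<open>K * l\<close>, after taking
    out the volume, the squared Barron norm and \<open>1 / l\<close>.\<close>
  define C where "C = (\<lambda>D. sqrt (2 * ((D / \<bar>a\<bar>)\<^sup>2 + K * A)))"
  have C0: "C D \<ge> 0" and C2: "(C D)\<^sup>2 = 2 * ((D / \<bar>a\<bar>)\<^sup>2 + K * A)" for D
    using K A0 by (auto simp: C_def)
  show ?thesis
  proof (intro exI[of _ C] allI impI)
    fix d n :: nat and \<Omega> f
    assume \<Omega>: "bounded_domain d \<Omega>" and f: "f \<in> barron_space d 1" and n: "n \<ge> 1"
    let ?D = "ediam d \<Omega>"
    have \<Omega>m[measurable]: "\<Omega> \<in> sets (leb d)" by (rule bounded_domain_sets[OF \<Omega>])
    obtain x0 where x0: "x0 \<in> \<Omega>" using \<Omega> by (auto simp: bounded_domain_def)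
    have D: "enorm d (\<lambda>i. x i - x0 i) \<le> ?D" if "x \<in> \<Omega>" for x
      by (rule bounded_domain_diam[OF \<Omega> that x0])
    obtain G where G: "integrable (leb d) G" and GB: "integrable (leb d) (\<lambda>w. (1 + enorm d w) * norm (G w))"
      and fB: "barron_norm d 1 f = ennreal (\<integral>w. (1 + enorm d w) * norm (G w) \<partial>leb d)"
      and fG: "AE x in leb d. f x = Re (\<integral>w. G w * iexp (dotp d w x) \<partial>leb d)"
      using barron_space_representation[OF f] by blast
    define B where "B = (\<integral>w. (1 + enorm d w) * norm (G w) \<partial>leb d)"
    have B0: "B \<ge> 0" unfolding B_def
      by (rule Bochner_Integration.integral_nonneg) (simp add: enorm_nonneg add_nonneg_nonneg)
    \<comment> \<open>The variance term \<open>l / n\<close> becomes \<open>1 / l\<close>, the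
      square of \<open>n powr (- 1/4)\<close>. The squared bias is of order \<open>1 / l^2\<close>,
      and \<open>l \<ge> 1\<close> weakens it to \<open>1 / l\<close>.\<close>
    define l where "l = sqrt (real n)"
    have l: "l \<ge> 1" "l\<^sup>2 = real n" using n by (auto simp: l_def)
    obtain k Bk where k: "k \<in> borel_measurable borel" "\<And>b. norm (k b) \<le> Bk"
      "(\<integral>\<^sup>+b. ennreal ((norm (k b))\<^sup>2) \<partial>lborel) \<le> ennreal (K * l)"
      "\<And>t. norm ((\<integral>b. s (t + b) *\<^sub>R k b \<partial>lborel) - iexp (- (a * t))) \<le> \<bar>t\<bar> / l"
      using ridge[OF l(1)] by blast
    have l0: "l > 0" and Kl: "K * l \<ge> 0" and n0: "n > 0" using l K n by auto
    obtain g where g: "g \<in> shallow_nets \<sigma> d n"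
      and le: "(\<integral>\<^sup>+x\<in>\<Omega>. ennreal ((Re (\<integral>w. G w * iexp (dotp d w x) \<partial>leb d) - g x)\<^sup>2) \<partial>leb d)
         \<le> ennreal (measure (leb d) \<Omega> * (2 * ((?D * B / (\<bar>a\<bar> * l))\<^sup>2 + K * l * B\<^sup>2 * A / real n)))"
      using ridge_network_approximation[OF s s2 \<sigma>s a l0 k(1,2,3) Kl k(4) G GB \<Omega>m bounded_domain_finite[OF \<Omega>] D n0]
      unfolding A_def B_def by blast
    define R where "R = measure (leb d) \<Omega> powr (1/2) * C ?D * real n powr (- 1/4) * B"
    have R0: "R \<ge> 0" using C0 B0 by (simp add: R_def)
    have "measure (leb d) \<Omega> * (2 * ((?D * B / (\<bar>a\<bar> * l))\<^sup>2 + K * l * B\<^sup>2 * A / real n)) \<le> R\<^sup>2"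
    proof -
      have n4: "(real n powr (- 1/4))\<^sup>2 = 1 / l"
      proof -
        have "(real n powr (- 1/4))\<^sup>2 = real n powr (- (1/2))"
          by (simp add: power2_eq_square powr_add[symmetric])
        then show ?thesis using n by (simp add: powr_minus_divide powr_half_sqrt l_def)
      qed
      have "(?D * B / (\<bar>a\<bar> * l))\<^sup>2 = (?D / \<bar>a\<bar>)\<^sup>2 * B\<^sup>2 * (1 / l * (1 / l))"
        by (simp add: power_divide power_mult_distrib power2_eq_square mult_ac)
      also have "\<dots> \<le> (?D / \<bar>a\<bar>)\<^sup>2 * B\<^sup>2 * (1 / l)"
        using l(1) by (intro mult_left_mono) (auto simp: field_simps)
      finally have 1: "(?D * B / (\<bar>a\<bar> * l))\<^sup>2 \<le> (?D / \<bar>a\<bar>)\<^sup>2 * B\<^sup>2 * (1 / l)" .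
      have 2: "K * l * B\<^sup>2 * A / real n = K * A * B\<^sup>2 * (1 / l)"
        using l0 unfolding l(2)[symmetric] by (simp add: power2_eq_square)
      have "R\<^sup>2 = measure (leb d) \<Omega> * (C ?D)\<^sup>2 * (1 / l) * B\<^sup>2"
        unfolding R_def power_mult_distrib n4 by (simp add: powr_half_sqrt)
      also have "\<dots> = measure (leb d) \<Omega> * (2 * ((?D / \<bar>a\<bar>)\<^sup>2 * B\<^sup>2 * (1 / l) + K * A * B\<^sup>2 * (1 / l)))"
        unfolding C2 by (simp add: algebra_simps)
      finally show ?thesis
        unfolding 2 using 1 by (auto intro!: mult_left_mono)
    qed
    with le have le': "(\<integral>\<^sup>+x\<in>\<Omega>. ennreal ((Re (\<integral>w. G w * iexp (dotp d w x) \<partial>leb d) - g x)\<^sup>2) \<partial>leb d) \<le> ennreal (R\<^sup>2)"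
      by (meson ennreal_leI order.trans)
    have "(\<integral>\<^sup>+x\<in>\<Omega>. ennreal ((f x - g x)\<^sup>2) \<partial>lebesgue_Rn d) = (\<integral>\<^sup>+x\<in>\<Omega>. ennreal ((f x - g x)\<^sup>2) \<partial>leb d)"
      unfolding lebesgue_Rn_def by (rule nn_integral_completion)
    also have "\<dots> = (\<integral>\<^sup>+x\<in>\<Omega>. ennreal ((Re (\<integral>w. G w * iexp (dotp d w x) \<partial>leb d) - g x)\<^sup>2) \<partial>leb d)"
      by (rule nn_integral_cong_AE, rule eventually_mono[OF fG]) simp
    finally have I: "(\<integral>\<^sup>+x\<in>\<Omega>. ennreal ((f x - g x)\<^sup>2) \<partial>lebesgue_Rn d) \<le> ennreal (R\<^sup>2)"
      using le' by simp
    have "L2_norm_on d \<Omega> (\<lambda>x. f x - g x) \<le> ennreal R"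
    proof -
      let ?I = "\<integral>\<^sup>+x\<in>\<Omega>. ennreal ((f x - g x)\<^sup>2) \<partial>lebesgue_Rn d"
      have "?I \<noteq> \<infinity>" using I by (auto simp: top_unique)
      moreover have "enn2real ?I \<le> R\<^sup>2" using enn2real_mono[OF I] by simp
      then have "sqrt (enn2real ?I) \<le> R" using R0 by (simp add: real_le_lsqrt)
      ultimately show ?thesis unfolding L2_norm_on_def Let_def by (simp add: ennreal_leI)
    qed
    then have "(INF g\<in>shallow_nets \<sigma> d n. L2_norm_on d \<Omega> (\<lambda>x. f x - g x)) \<le> ennreal R"
      using g by (rule INF_lower2[rotated])
    also have "ennreal R = ennreal (measure (lebesgue_Rn d) \<Omega> powr (1/2) * C ?D * real n powr (- 1/4)) * barron_norm d 1 f"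
      unfolding fB B_def[symmetric] R_def
      using C0 B0 \<Omega>m by (simp add: lebesgue_Rn_def ennreal_mult')
    finally show "(INF g\<in>shallow_nets \<sigma> d n. L2_norm_on d \<Omega> (\<lambda>x. f x - g x))
         \<le> ennreal (measure (lebesgue_Rn d) \<Omega> powr (1/2) * C ?D * real n powr (- 1/4)) * barron_norm d 1 f" .
  qed
qed

theorem corollary2:
  fixes \<sigma> :: "real \<Rightarrow> real"
  assumes L1: "integrable lebesgue \<sigma>"
    and Linf: "\<exists>M. AE t in lebesgue. \<bar>\<sigma> t\<bar> \<le> M"
    and nonzero: "\<not> (AE t in lebesgue. \<sigma> t = 0)"
  shows "\<exists>C :: real \<Rightarrow> real. \<forall>(d::nat) \<Omega> f (n::nat).
           d \<ge> 1 \<longrightarrow> bounded_domain d \<Omega> \<longrightarrow> f \<in> barron_space d 1 \<longrightarrow> n \<ge> 1 \<longrightarrow>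
             (INF g\<in>shallow_nets \<sigma> d n. L2_norm_on d \<Omega> (\<lambda>x. f x - g x))
               \<le> ennreal (measure (lebesgue_Rn d) \<Omega> powr (1/2) * C (ediam d \<Omega>) * real n powr (- 1/4))
                  * barron_norm d 1 f"
proof -
  obtain s where s_meas[measurable]: "s \<in> borel_measurable lborel" and \<sigma>s: "AE t in lborel. \<sigma> t = s t"
    using completion_ex_borel_measurable_real[of \<sigma> lborel] L1 by auto
  have s: "integrable lborel s"
  proof -
    have "s \<in> borel_measurable lebesgue" by (rule measurable_completion[OF s_meas])
    then have "integrable lebesgue s"
      using L1 \<sigma>s by (subst integrable_cong_AE[of s lebesgue \<sigma>]) (auto simp: AE_completion_iff eq_commute)
    then show ?thesis by (simp add: integrable_completion)
  qed
  obtain M where M: "AE t in lborel. \<bar>\<sigma> t\<bar> \<le> M"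
    using Linf by (auto simp: AE_completion_iff)
  \<comment> \<open>The essential bound enters only here: \<open>s^2 \<le> |M| |s|\<close> almost
    everywhere gives the square integrability behind the variance estimate.\<close>
  have s2: "integrable lborel (\<lambda>t. (s t)\<^sup>2)"
  proof (rule Bochner_Integration.integrable_bound)
    show "integrable lborel (\<lambda>t. M * \<bar>s t\<bar>)" using s by auto
    show "AE t in lborel. norm ((s t)\<^sup>2) \<le> norm (M * \<bar>s t\<bar>)"
      using \<sigma>s M
    proof eventually_elim
      case (elim t)
      have "\<bar>s t\<bar> * \<bar>s t\<bar> \<le> \<bar>M\<bar> * \<bar>s t\<bar>" using elim by (intro mult_right_mono) auto
      then show ?case by (simp add: power2_eq_square abs_mult)
    qed
  qed measurable
  have nz: "\<not> (AE t in lborel. s t = 0)"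
  proof
    assume "AE t in lborel. s t = 0"
    with \<sigma>s have "AE t in lborel. \<sigma> t = 0" by eventually_elim simp
    then show False using nonzero by (simp add: AE_completion_iff)
  qed
  show ?thesis by (rule shallow_network_rate[OF s s2 nz \<sigma>s])
qed

end
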